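(* Let $n\ge 1$, let $(K_1,d_{K_1}),\dots,(K_n,d_{K_n})$ be complete and separable metric spaces of diameter at most $1$, let $\delta>0$, and let $\mu$ be a Borel probability measure on $\prod_{i=1}^n K_i$. If $\mathrm{DTC}(\mu)\le \delta^3 n$, then $\mu$ may be written as a mixture $$\mu=\int_L \mu_y\,\nu(\mathrm{d}y)$$ (that is, there are a measurable space $L$, a probability measure $\nu$ on $L$, and a kernel $y\mapsto\mu_y$ from $L$ to $\prod_i K_i$ for which this holds) so that (a) the mutual information in the mixture satisfies $\mathrm{I}(\nu,\mu_\bullet)\le \mathrm{DTC}(\mu)$, and (b) there is a measurable family $(\xi_y:\ y\in L)$ of product measures on $\prod_i K_i$ such that $$\int_L \overline{d_n}(\mu_y,\xi_y)\,\nu(\mathrm{d}y)<2\delta.$$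
   Context: Logarithms are natural. $\mathrm{H}$ denotes Shannon entropy of finite-valued random variables and $\mathrm{H}(\cdot\,|\,\cdot)$ conditional Shannon entropy. For a random variable $X$ in a measurable space $K$ and a finite measurable partition $\mathcal{P}$ of $K$, the quantization $[X]_{\mathcal{P}}$ is the $\mathcal{P}$-valued random variable equal to the cell containing $X$. For general random variables $\mathrm{I}(X;Y)=\sup_{\mathcal{P},\mathcal{Q}}\mathrm{I}([X]_{\mathcal{P}};[Y]_{\mathcal{Q}})$ over all finite quantizations, where for finite-valued variables $\mathrm{I}(X;Y)=\mathrm{H}(X)+\mathrm{H}(Y)-\mathrm{H}(X,Y)$. Dual total correlation: for finite-valued $X_1,\dots,X_n$, $\mathrm{DTC}(X_1;\dots;X_n)=\mathrm{H}(X_1,\dots,X_n)-\sum_{i=1}^n\mathrm{H}(X_i\,|\,(X_j)_{j\ne i})$; for general $X_i$ taking values in measurable spaces $K_i$, $\mathrm{DTC}(X_1;\dots;X_n)=\sup\mathrm{DTC}([X_1]_{\mathcal{P}_1};\dots;[X_n]_{\mathcal{P}_n})$ over all tuples of finite measurable partitions $\mathcal{P}_i$ of $K_i$ (possibly $+\infty$). For a probability measure $\mu$ on $\prod_i K_i$, $\mathrm{DTC}(\mu)$ is the DTC of random variables $(X_1,\dots,X_n)$ with joint distribution $\mu$. Mixtures: given a measurable space $L$, a probability measure $\nu$ on $L$ and a kernel $y\mapsto\mu_y$ from $L$ to $K$, the mixture is $\mu(A)=\int_L\mu_y(A)\,\nu(\mathrm{d}y)$. The mutual information in the mixture is $\mathrm{I}(\nu,\mu_\bullet):=\mathrm{I}(Y;X)$,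 where $(Y,X)$ is a random pair with $Y\sim\nu$ and with $\mu_y$ as the conditional distribution of $X$ given $Y=y$. Metrics: $d_n(x,y):=\frac1n\sum_{i=1}^n d_{K_i}(x_i,y_i)$ on $\prod_i K_i$, and $\overline{d_n}(\mu,\nu):=\inf_\lambda\int d_n(x,y)\,\lambda(\mathrm{d}x,\mathrm{d}y)$, where $\lambda$ ranges over all couplings of the Borel probability measures $\mu,\nu$ on $\prod_i K_i$. A product measure on $\prod_i K_i$ is one of the form $\eta_1\times\cdots\times\eta_n$ with each $\eta_i$ a Borel probability measure on $K_i$. A measurable family of measures is a kernel. *)

theory Defs
  imports "HOL-Probability.Probability"
begin

definition borel_of :: "'a topology \<Rightarrow> 'a measure" where
  "borel_of T = sigma (topspace T) {U. openin T U}"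

lemma space_borel_of [simp]: "space (borel_of T) = topspace T"
  and sets_borel_of: "sets (borel_of T) = sigma_sets (topspace T) {U. openin T U}"
  unfolding borel_of_def
  by (auto intro!: space_measure_of sets_measure_of dest: openin_subset)

lemma borel_of_open: "openin T U \<Longrightarrow> U \<in> sets (borel_of T)"
  by (auto simp: sets_borel_of)


text \<open>The entropies below are meant for finite-valued variables only; base \<^term>\<open>exp 1\<close> makes
  the logarithm natural.\<close>

definition finite_partitions :: "'a measure \<Rightarrow> 'a set set set" where
  "finite_partitions K = {P. finite P \<and> P \<subseteq> sets K \<and> partition_on (space K) P}"

definition quantize :: "'a set set \<Rightarrow> 'a \<Rightarrow> 'a set" where
  "quantize P x = (THE C. C \<in> P \<and> x \<in> C)"

definition Ent :: "'w measure \<Rightarrow> ('w \<Rightarrow> 'b) \<Rightarrow> real" where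
  "Ent M X = prob_space.entropy M (exp 1) (count_space (X ` space M)) X"

definition cond_Ent :: "'w measure \<Rightarrow> ('w \<Rightarrow> 'b) \<Rightarrow> ('w \<Rightarrow> 'c) \<Rightarrow> real" where
  "cond_Ent M X Y = prob_space.conditional_entropy M (exp 1)
     (count_space (X ` space M)) (count_space (Y ` space M)) X Y"


text \<open>The real-valued \<^const>\<open>prob_space.mutual_information\<close> cannot be infinite; the supremum over
  finite quantizations is therefore taken in \<^typ>\<open>ereal\<close>.\<close>

definition finite_mutual_info :: "'w measure \<Rightarrow> ('w \<Rightarrow> 'b) \<Rightarrow> ('w \<Rightarrow> 'c) \<Rightarrow> real" where
  "finite_mutual_info M X Y = Ent M X + Ent M Y - Ent M (\<lambda>w. (X w, Y w))"

definition mutual_info ::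
    "'w measure \<Rightarrow> 'b measure \<Rightarrow> 'c measure \<Rightarrow> ('w \<Rightarrow> 'b) \<Rightarrow> ('w \<Rightarrow> 'c) \<Rightarrow> ereal" where
  "mutual_info M S T X Y =
     (SUP (P, Q) \<in> finite_partitions S \<times> finite_partitions T.
        ereal (finite_mutual_info M (\<lambda>w. quantize P (X w)) (\<lambda>w. quantize Q (Y w))))"

definition finite_DTC :: "'w measure \<Rightarrow> 'i set \<Rightarrow> ('i \<Rightarrow> 'w \<Rightarrow> 'b) \<Rightarrow> real" where
  "finite_DTC M I X = Ent M (\<lambda>w. \<lambda>i\<in>I. X i w)
     - (\<Sum>i\<in>I. cond_Ent M (X i) (\<lambda>w. \<lambda>j\<in>I - {i}. X j w))"

definition DTC :: "'w measure \<Rightarrow> 'i set \<Rightarrow> ('i \<Rightarrow> 'b measure) \<Rightarrow> ('i \<Rightarrow> 'w \<Rightarrow> 'b) \<Rightarrow> ereal" where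
  "DTC M I K X =
     (SUP P \<in> {P. \<forall>i\<in>I. P i \<in> finite_partitions (K i)}.
        ereal (finite_DTC M I (\<lambda>i w. quantize (P i) (X i w))))"

definition DTC_measure :: "'i set \<Rightarrow> ('i \<Rightarrow> 'b measure) \<Rightarrow> ('i \<Rightarrow> 'b) measure \<Rightarrow> ereal" where
  "DTC_measure I K \<mu> = DTC \<mu> I K (\<lambda>i x. x i)"


definition mixture_joint ::
    "'l measure \<Rightarrow> 'k measure \<Rightarrow> 'l measure \<Rightarrow> ('l \<Rightarrow> 'k measure) \<Rightarrow> ('l \<times> 'k) measure" where
  "mixture_joint L K \<nu> \<kappa> = \<nu> \<bind> (\<lambda>y. \<kappa> y \<bind> (\<lambda>x. return (L \<Otimes>\<^sub>M K) (y, x)))"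

definition mixture_info ::
    "'l measure \<Rightarrow> 'k measure \<Rightarrow> 'l measure \<Rightarrow> ('l \<Rightarrow> 'k measure) \<Rightarrow> ereal" where
  "mixture_info L K \<nu> \<kappa> = mutual_info (mixture_joint L K \<nu> \<kappa>) L K fst snd"


text \<open>The factors \<open>K\<^sub>i\<close> are metrics whose carriers \<^term>\<open>mspace (K i)\<close> lie in a common type.\<close>

definition product_borel :: "nat \<Rightarrow> (nat \<Rightarrow> 'a metric) \<Rightarrow> (nat \<Rightarrow> 'a) measure" where
  "product_borel n K = borel_of (product_topology (\<lambda>i. mtopology_of (K i)) {1..n})"

definition avg_dist :: "nat \<Rightarrow> (nat \<Rightarrow> 'a metric) \<Rightarrow> (nat \<Rightarrow> 'a) \<Rightarrow> (nat \<Rightarrow> 'a) \<Rightarrow> real" where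
  "avg_dist n K x y = (1 / real n) * (\<Sum>i=1..n. mdist (K i) (x i) (y i))"

definition couplings :: "'k measure \<Rightarrow> 'k measure \<Rightarrow> ('k \<times> 'k) measure set" where
  "couplings \<mu> \<nu> = {\<pi>\<in>space (prob_algebra (\<mu> \<Otimes>\<^sub>M \<nu>)). distr \<pi> \<mu> fst = \<mu> \<and> distr \<pi> \<nu> snd = \<nu>}"

definition transport_dist ::
    "nat \<Rightarrow> (nat \<Rightarrow> 'a metric) \<Rightarrow> (nat \<Rightarrow> 'a) measure \<Rightarrow> (nat \<Rightarrow> 'a) measure \<Rightarrow> ennreal" where
  "transport_dist n K \<mu> \<nu> =
     (INF \<pi>\<in>couplings \<mu> \<nu>. \<integral>\<^sup>+ (x, y). ennreal (avg_dist n K x y) \<partial>\<pi>)"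

definition is_product_measure :: "nat \<Rightarrow> (nat \<Rightarrow> 'a metric) \<Rightarrow> (nat \<Rightarrow> 'a) measure \<Rightarrow> bool" where
  "is_product_measure n K \<xi> \<longleftrightarrow>
     (\<exists>\<eta>. (\<forall>i\<in>{1..n}. \<eta> i \<in> space (prob_algebra (borel_of (mtopology_of (K i)))))
        \<and> \<xi> = PiM {1..n} \<eta>)"


text \<open>\<^const>\<open>PiM\<close> carries the product \<open>\<sigma>\<close>-algebra, which for separable metric factors is the
  Borel \<open>\<sigma>\<close>-algebra of the product topology.\<close>

lemma sets_PiM_borel_of:
  assumes I: "finite I" and sc: "\<And>i. i \<in> I \<Longrightarrow> second_countable (T i)"
  shows "sets (PiM I (\<lambda>i. borel_of (T i))) = sets (borel_of (product_topology T I))"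
proof (rule antisym)
  let ?P = "product_topology T I"
  show "sets (PiM I (\<lambda>i. borel_of (T i))) \<subseteq> sets (borel_of ?P)"
  proof -
    have "(\<lambda>x. x) \<in> borel_of ?P \<rightarrow>\<^sub>M PiM I (\<lambda>i. borel_of (T i))"
    proof (rule measurable_PiM_single')
      fix i assume i: "i \<in> I"
      show "(\<lambda>x. x i) \<in> borel_of ?P \<rightarrow>\<^sub>M borel_of (T i)"
        unfolding borel_of_def[of "T i"]
      proof (rule measurable_measure_of)
        show "{U. openin (T i) U} \<subseteq> Pow (topspace (T i))"
          by (auto dest: openin_subset)
        show "(\<lambda>x. x i) \<in> space (borel_of ?P) \<rightarrow> topspace (T i)"
          using i by auto
        fix U assume "U \<in> {U. openin (T i) U}"
        then have "openin ?P {x \<in> topspace ?P. x i \<in> U}"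
          using continuous_map_product_projection[OF i, of T] by (auto simp: continuous_map_def)
        moreover have "(\<lambda>x. x i) -` U \<inter> space (borel_of ?P) = {x \<in> topspace ?P. x i \<in> U}"
          by auto
        ultimately show "(\<lambda>x. x i) -` U \<inter> space (borel_of ?P) \<in> sets (borel_of ?P)"
          by (simp add: borel_of_open)
      qed
    next
      show "(\<lambda>x. x) \<in> space (borel_of ?P) \<rightarrow> (\<Pi>\<^sub>E i\<in>I. space (borel_of (T i)))"
        by simp
    qed
    then have "(\<lambda>x. x) -` A \<inter> space (borel_of ?P) \<in> sets (borel_of ?P)"
      if "A \<in> sets (PiM I (\<lambda>i. borel_of (T i)))" for A
      using that by (rule measurable_sets)
    moreover have "A \<subseteq> space (borel_of ?P)" if "A \<in> sets (PiM I (\<lambda>i. borel_of (T i)))" for A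
      using sets.sets_into_space[OF that] by (simp add: space_PiM)
    ultimately show ?thesis
      by (auto simp: Int_absorb2)
  qed
  have "\<forall>i\<in>I. \<exists>B. countable B \<and> (\<forall>V\<in>B. openin (T i) V) \<and>
      (\<forall>U x. openin (T i) U \<and> x \<in> U \<longrightarrow> (\<exists>V\<in>B. x \<in> V \<and> V \<subseteq> U))"
    using sc unfolding second_countable_def by blast
  then obtain B where B: "\<And>i. i \<in> I \<Longrightarrow> countable (B i)"
      "\<And>i V. i \<in> I \<Longrightarrow> V \<in> B i \<Longrightarrow> openin (T i) V"
      "\<And>i U x. i \<in> I \<Longrightarrow> openin (T i) U \<Longrightarrow> x \<in> U \<Longrightarrow> \<exists>V\<in>B i. x \<in> V \<and> V \<subseteq> U"
    by metis
  have op: "W \<in> sets (PiM I (\<lambda>i. borel_of (T i)))" if W: "openin ?P W" for W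
  proof -
    define C where "C = {V \<in> Pi\<^sub>E I B. Pi\<^sub>E I V \<subseteq> W}"
    have "countable C"
      unfolding C_def by (rule countable_subset[OF _ countable_PiE[OF I B(1)]]) auto
    moreover have "W = (\<Union>V\<in>C. Pi\<^sub>E I V)"
    proof
      show "W \<subseteq> (\<Union>V\<in>C. Pi\<^sub>E I V)"
      proof
        fix x assume x: "x \<in> W"
        obtain U where U: "\<And>i. i \<in> I \<Longrightarrow> openin (T i) (U i)" "x \<in> Pi\<^sub>E I U" "Pi\<^sub>E I U \<subseteq> W"
          using W x unfolding openin_product_topology_alt by meson
        have "\<exists>V. V \<in> B i \<and> x i \<in> V \<and> V \<subseteq> U i" if i: "i \<in> I" for i
          using B(3)[OF i U(1)[OF i] PiE_mem[OF U(2) i]] by blast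
        then obtain V where V: "\<And>i. i \<in> I \<Longrightarrow> V i \<in> B i \<and> x i \<in> V i \<and> V i \<subseteq> U i"
          by metis
        have eq: "Pi\<^sub>E I (restrict V I) = Pi\<^sub>E I V"
          by (intro PiE_cong) auto
        have "Pi\<^sub>E I V \<subseteq> W"
          using V U(3) PiE_mono[of I V U] by blast
        then have "restrict V I \<in> C"
          unfolding C_def using V eq by auto
        moreover have "x \<in> Pi\<^sub>E I (restrict V I)"
          using U(2) V eq by (auto simp: PiE_iff)
        ultimately show "x \<in> (\<Union>V\<in>C. Pi\<^sub>E I V)" by blast
      qed
    qed (auto simp: C_def)
    moreover have "Pi\<^sub>E I V \<in> sets (PiM I (\<lambda>i. borel_of (T i)))" if "V \<in> C" for V
      using that I B(2) unfolding C_def by (intro sets_PiM_I_finite) (auto intro: borel_of_open)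
    ultimately show ?thesis
      by (auto intro!: sets.countable_UN')
  qed
  have sp: "topspace ?P = space (PiM I (\<lambda>i. borel_of (T i)))"
    by (simp add: space_PiM)
  show "sets (borel_of ?P) \<subseteq> sets (PiM I (\<lambda>i. borel_of (T i)))"
    unfolding sets_borel_of sp using op by (intro sets.sigma_sets_subset) auto
qed

lemma second_countable_mtopology_of:
  assumes "separable_space (mtopology_of m)"
  shows "second_countable (mtopology_of m)"
proof -
  interpret Metric_space "mspace m" "mdist m"
    by (rule Metric_space_mspace_mdist)
  obtain C where C: "countable C" "C \<subseteq> mspace m" "mtopology closure_of C = mspace m"
    using assms unfolding separable_space_def mtopology_of_def by auto
  define B where "B = (\<lambda>(c, k). mball c (inverse (real (Suc k)))) ` (C \<times> (UNIV :: nat set))"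
  have "\<exists>V\<in>B. x \<in> V \<and> V \<subseteq> U" if U: "openin mtopology U" "x \<in> U" for U x
  proof -
    obtain r where r: "r > 0" "mball x r \<subseteq> U"
      using U unfolding openin_mtopology by blast
    have x: "x \<in> mspace m"
      using U unfolding openin_mtopology by blast
    obtain k where k: "inverse (real (Suc k)) < r / 2"
      using r(1) reals_Archimedean[of "r / 2"] by auto
    let ?e = "inverse (real (Suc k))"
    have "x \<in> mtopology closure_of C"
      using C(3) x by simp
    moreover have "?e > 0"
      by simp
    ultimately obtain c where c: "c \<in> C" "c \<in> mball x ?e"
      unfolding metric_closure_of by blast
    have "mball c ?e \<subseteq> mball x r"
    proof
      fix z assume z: "z \<in> mball c ?e"
      have "mdist m x z \<le> mdist m x c + mdist m c z"
        using x z c(2) by (intro triangle) auto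
      also have "\<dots> < ?e + ?e"
        using z c(2) by (intro add_strict_mono) (auto simp only: in_mball)
      also have "\<dots> < r"
        using k by linarith
      finally show "z \<in> mball x r"
        using x z by (simp only: in_mball)
    qed
    moreover have "x \<in> mball c ?e"
      using c(2) by (simp only: in_mball commute)
    moreover have "mball c ?e \<in> B"
      using c(1) unfolding B_def by auto
    ultimately show ?thesis
      using r(2) by blast
  qed
  moreover have "countable B"
    unfolding B_def using C(1) by simp
  moreover have "\<forall>V\<in>B. openin mtopology V"
    unfolding B_def by auto
  ultimately show ?thesis
    unfolding second_countable_def mtopology_of_def by blast
qed

lemma sets_product_borel:
  assumes "\<And>i. i \<in> {1..n} \<Longrightarrow> separable_space (mtopology_of (K i))"
  shows "sets (product_borel n K) = sets (PiM {1..n} (\<lambda>i. borel_of (mtopology_of (K i))))"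
  unfolding product_borel_def
  by (rule sets_PiM_borel_of[symmetric])
     (use assms second_countable_mtopology_of in auto)

end

theory Submission
  imports Defs
begin

text \<open>Quantize each coordinate \<open>X\<^sub>i\<close> to the cell \<open>C\<^sub>i\<close> of a finite partition that contains it,
where all cells but a set of small probability have small diameter. For \<open>A \<subseteq> I = {1..n}\<close> let
\<open>H(A)\<close> be the entropy of \<open>(C\<^sub>i)\<^sub>i\<^sub>\<in>\<^sub>A\<close> and put \<open>h\<^sub>i = H(I) - H(I - {i})\<close>, so that the quantized
dual total correlation is \<open>D = H(I) - \<Sum>i\<in>I. h\<^sub>i\<close>; it is at most \<open>DTC(\<mu>)\<close>.

The coordinates to condition on form a set \<open>S\<close> found by an extremal choice. By submodularity of
entropy, \<open>F(A) = H(A) - \<Sum>i\<in>A. h\<^sub>i\<close> increases from \<open>F({}) = 0\<close> to \<open>F(I) = D\<close>. Take a largest \<open>S\<close>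
with \<open>F(S) \<ge> t |S|\<close>. Then \<open>t |S| \<le> D\<close>, and by maximality \<open>F(S \<union> {i}) - F(S) < t\<close> for each \<open>i \<notin>
S\<close>. That increment is precisely the conditional mutual information of \<open>C\<^sub>i\<close> and all other cells
given \<open>C\<^sub>S = (C\<^sub>j)\<^sub>j\<^sub>\<in>\<^sub>S\<close> (\<open>saturated_subset\<close>, \<open>expectation_tv_le\<close>).

Given these coordinates the others are close to independent. Relative entropy dominates the
square of the total variation distance, so that given \<open>C\<^sub>S\<close> each \<open>C\<^sub>i\<close> with \<open>i \<notin> S\<close> is on
average within \<open>\<surd>t\<close> in total variation of being independent of the other cells. Revealing the
coordinates one after the other and coupling each of them optimally with an independent copy
gives a coupling of the conditional law with the product of its marginals in which every single
coordinate outside \<open>S\<close> fails to agree with probability at most \<open>\<surd>t\<close> on average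
(\<open>product_coupling\<close>). The coordinates in \<open>S\<close> may cost \<open>1\<close> each. With \<open>t = (6\<delta>/5)\<^sup>2\<close> and \<open>D \<le> \<delta>\<^sup>3
n\<close> the total is at most \<open>|S|/n + \<surd>t \<le> 25\<delta>/36 + 6\<delta>/5 < 2\<delta>\<close>, which leaves room for the
quantization error.

It remains to keep the mutual information small. Conditioning \<open>\<mu>\<close> on \<open>C\<^sub>S\<close> itself would give a
mixture of information \<open>H(S)\<close>, for which there is no bound. Let \<open>T = I - S\<close>. The mixture used
instead has the index \<open>Y = C\<^sub>S\<close>, and its component \<open>\<mu>\<^sub>y\<close> draws \<open>C\<^sub>T\<close> from its conditional law
given \<open>C\<^sub>S = y\<close> and then draws all of \<open>X\<close> from \<open>\<mu>\<close> conditioned on that value of \<open>C\<^sub>T\<close> only. The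
coordinates in \<open>S\<close> are thereby resampled, which has already been paid for above. The law of
\<open>C\<^sub>T\<close> is unchanged, so the mixture is \<open>\<mu>\<close>; and the index influences \<open>X\<close> only through \<open>C\<^sub>T\<close>, so
by data processing the mutual information is at most \<open>I(C\<^sub>S; C\<^sub>T)\<close>, which submodularity bounds
by \<open>D\<close> (\<open>mixture_info_le_pmf_MI\<close>, \<open>pmf_MI_split_le_DTC\<close>).\<close>

section \<open>Relative entropy, mutual information and total variation\<close>

text \<open>Entropy and relative entropy are written as expectations of logarithms of probabilities,
not as sums: identities for marginals then reduce to linearity of the integral and the change of
variables \<open>integral_map_pmf\<close>.\<close>

definition pmf_entropy :: "'a pmf \<Rightarrow> real" where
  "pmf_entropy p = measure_pmf.expectation p (\<lambda>x. - ln (pmf p x))"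

definition pmf_KL :: "'a pmf \<Rightarrow> 'a pmf \<Rightarrow> real" where
  "pmf_KL p q = measure_pmf.expectation p (\<lambda>x. ln (pmf p x / pmf q x))"

definition pmf_MI :: "('a \<times> 'b) pmf \<Rightarrow> real" where
  "pmf_MI J = pmf_entropy (map_pmf fst J) + pmf_entropy (map_pmf snd J) - pmf_entropy J"

text \<open>Mutual information is the relative entropy of \<open>J\<close> with respect to this law
(\<open>pmf_MI_eq_KL\<close>).\<close>

definition indep_pmf :: "('a \<times> 'b) pmf \<Rightarrow> ('a \<times> 'b) pmf" where
  "indep_pmf J = pair_pmf (map_pmf fst J) (map_pmf snd J)"

definition pmf_tv :: "'a pmf \<Rightarrow> 'a pmf \<Rightarrow> real" where
  "pmf_tv p q = (\<Sum>x\<in>set_pmf p \<union> set_pmf q. \<bar>pmf p x - pmf q x\<bar>) / 2"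

lemma expectation_cong_pmf:
  assumes "\<And>x. x \<in> set_pmf p \<Longrightarrow> f x = g x"
  shows "measure_pmf.expectation p f = measure_pmf.expectation p g"
  by (rule integral_cong_AE) (auto simp: AE_measure_pmf_iff assms)

lemma expectation_mono_pmf:
  fixes f g :: "'a \<Rightarrow> real"
  assumes "finite (set_pmf p)" "\<And>x. x \<in> set_pmf p \<Longrightarrow> f x \<le> g x"
  shows "measure_pmf.expectation p f \<le> measure_pmf.expectation p g"
  using assms
  by (intro integral_mono_AE integrable_measure_pmf_finite) (auto simp: AE_measure_pmf_iff)

lemma expectation_sum_pmf:
  fixes f :: "'a \<Rightarrow> real"
  assumes "finite A" "set_pmf p \<subseteq> A"
  shows "measure_pmf.expectation p f = (\<Sum>x\<in>A. pmf p x * f x)"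
  using assms by (subst integral_measure_pmf[of A]) auto

lemma pmf_entropy_map:
  "pmf_entropy (map_pmf f p) = measure_pmf.expectation p (\<lambda>x. - ln (pmf (map_pmf f p) (f x)))"
  by (simp add: pmf_entropy_def)

text \<open>Entropy depends on a random variable only through the partition that it generates; this
identifies the entropies of differently encoded tuples of the same coordinates.\<close>

lemma pmf_entropy_map_cong:
  assumes "\<And>x y. x \<in> set_pmf p \<Longrightarrow> y \<in> set_pmf p \<Longrightarrow> f x = f y \<longleftrightarrow> g x = g y"
  shows "pmf_entropy (map_pmf f p) = pmf_entropy (map_pmf g p)"
proof -
  have "measure p (f -` {f x}) = measure p (g -` {g x})" if "x \<in> set_pmf p" for x
    using that by (intro measure_pmf.finite_measure_eq_AE) (auto simp: AE_measure_pmf_iff assms)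
  then show ?thesis
    unfolding pmf_entropy_map by (intro expectation_cong_pmf) (simp add: pmf_map)
qed

text \<open>Data processing for a deterministic map, from \<open>ln r \<le> r - 1\<close> applied to the quotient \<open>r\<close>
of the two likelihood ratios: the expectation of \<open>r\<close> under \<open>p\<close> is at most the total mass of the
image of \<open>p\<close>.\<close>

lemma pmf_KL_map_le:
  assumes fin: "finite (set_pmf q)" and ac: "set_pmf p \<subseteq> set_pmf q"
  shows "pmf_KL (map_pmf f p) (map_pmf f q) \<le> pmf_KL p q"
proof -
  define P Q where "P = map_pmf f p" and "Q = map_pmf f q"
  have fp: "finite (set_pmf p)"
    using fin ac by (rule finite_subset[rotated])
  have sPQ: "set_pmf P \<subseteq> set_pmf Q"
    unfolding P_def Q_def using ac by auto
  have fQ: "finite (set_pmf Q)"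
    unfolding Q_def using fin by auto
  have le: "ln (pmf P (f x) / pmf Q (f x)) - ln (pmf p x / pmf q x)
      \<le> (pmf P (f x) / pmf Q (f x)) * (pmf q x / pmf p x) - 1" if x: "x \<in> set_pmf p" for x
  proof -
    have pos: "pmf P (f x) > 0" "pmf Q (f x) > 0" "pmf p x > 0" "pmf q x > 0"
      using x ac by (auto simp: P_def Q_def pmf_positive_iff)
    have "ln (pmf P (f x) / pmf Q (f x)) - ln (pmf p x / pmf q x)
        = ln ((pmf P (f x) / pmf Q (f x)) * (pmf q x / pmf p x))"
      using pos by (simp add: ln_div ln_mult)
    also have "\<dots> \<le> (pmf P (f x) / pmf Q (f x)) * (pmf q x / pmf p x) - 1"
      using pos by (intro ln_le_minus_one) auto
    finally show ?thesis .
  qed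
  have "pmf_KL P Q - pmf_KL p q
      = measure_pmf.expectation p (\<lambda>x. ln (pmf P (f x) / pmf Q (f x)) - ln (pmf p x / pmf q x))"
    using fp unfolding pmf_KL_def P_def Q_def
    by (subst Bochner_Integration.integral_diff) (auto intro: integrable_measure_pmf_finite)
  also have "\<dots> \<le> measure_pmf.expectation p
      (\<lambda>x. (pmf P (f x) / pmf Q (f x)) * (pmf q x / pmf p x) - 1)"
    by (rule expectation_mono_pmf[OF fp le])
  also have "\<dots> = (\<Sum>x\<in>set_pmf p. pmf q x * (pmf P (f x) / pmf Q (f x))) - 1"
  proof -
    have "measure_pmf.expectation p (\<lambda>x. (pmf P (f x) / pmf Q (f x)) * (pmf q x / pmf p x))
      = (\<Sum>x\<in>set_pmf p. pmf q x * (pmf P (f x) / pmf Q (f x)))"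
      by (subst expectation_sum_pmf[OF fp order_refl]) (auto intro!: sum.cong simp: set_pmf_iff)
    then show ?thesis
      using fp by (subst Bochner_Integration.integral_diff) (auto intro: integrable_measure_pmf_finite)
  qed
  also have "(\<Sum>x\<in>set_pmf p. pmf q x * (pmf P (f x) / pmf Q (f x)))
      \<le> (\<Sum>x\<in>set_pmf q. pmf q x * (pmf P (f x) / pmf Q (f x)))"
    using fin ac by (intro sum_mono2) auto
  also have "\<dots> = measure_pmf.expectation Q (\<lambda>z. pmf P z / pmf Q z)"
    unfolding Q_def by (simp add: expectation_sum_pmf[OF fin])
  also have "\<dots> = (\<Sum>z\<in>set_pmf Q. pmf P z)"
    by (subst expectation_sum_pmf[OF fQ order_refl]) (auto intro!: sum.cong simp: set_pmf_iff)
  also have "\<dots> = 1"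
    using fQ sPQ by (rule sum_pmf_eq_1)
  finally show ?thesis
    unfolding P_def Q_def by simp
qed

text \<open>The law of a pair whose first component has law \<open>p\<close> and whose second component has
conditional law \<open>k x\<close> given that the first is \<open>x\<close>.\<close>

definition joint_pmf :: "'a pmf \<Rightarrow> ('a \<Rightarrow> 'b pmf) \<Rightarrow> ('a \<times> 'b) pmf" where
  "joint_pmf p k = bind_pmf p (\<lambda>x. map_pmf (Pair x) (k x))"

lemma pmf_joint [simp]: "pmf (joint_pmf p k) (x, z) = pmf p x * pmf (k x) z"
proof -
  have "pmf (joint_pmf p k) (x, z)
      = measure_pmf.expectation p (\<lambda>y. indicator {x} y * pmf (k x) z)"
    unfolding joint_pmf_def pmf_bind
  proof (rule expectation_cong_pmf)
    fix y
    show "pmf (map_pmf (Pair y) (k y)) (x, z) = indicator {x} y * pmf (k x) z"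
    proof (cases "y = x")
      case True
      then show ?thesis
        using pmf_map_inj'[of "Pair x" "k x" z] by (simp add: inj_on_def)
    next
      case False
      then show ?thesis
        by (auto intro!: pmf_map_outside)
    qed
  qed
  also have "\<dots> = pmf p x * pmf (k x) z"
    by (simp add: measure_pmf_single)
  finally show ?thesis .
qed

lemma map_fst_joint [simp]: "map_pmf fst (joint_pmf p k) = p"
  and map_snd_joint: "map_pmf snd (joint_pmf p k) = bind_pmf p k"
  by (simp_all add: joint_pmf_def map_bind_pmf pmf.map_comp o_def bind_return_pmf')

text \<open>Adjoining the output of the same kernel to both laws does not change the likelihood ratio,
and forgetting the input afterwards is a deterministic map.\<close>

lemma pmf_KL_bind_le:
  assumes fin: "finite (set_pmf q)" "\<And>x. x \<in> set_pmf q \<Longrightarrow> finite (set_pmf (k x))"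
    and ac: "set_pmf p \<subseteq> set_pmf q"
  shows "pmf_KL (bind_pmf p k) (bind_pmf q k) \<le> pmf_KL p q"
proof -
  have "pmf_KL (bind_pmf p k) (bind_pmf q k) \<le> pmf_KL (joint_pmf p k) (joint_pmf q k)"
    unfolding map_snd_joint[symmetric]
    by (rule pmf_KL_map_le) (use fin ac in \<open>auto simp: joint_pmf_def\<close>)
  also have "\<dots> = measure_pmf.expectation (joint_pmf p k) (\<lambda>w. ln (pmf p (fst w) / pmf q (fst w)))"
    unfolding pmf_KL_def
  proof (rule expectation_cong_pmf)
    fix w assume "w \<in> set_pmf (joint_pmf p k)"
    then show "ln (pmf (joint_pmf p k) w / pmf (joint_pmf q k) w) = ln (pmf p (fst w) / pmf q (fst w))"
      by (cases w) (simp add: set_pmf_iff)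
  qed
  also have "\<dots> = measure_pmf.expectation (map_pmf fst (joint_pmf p k)) (\<lambda>x. ln (pmf p x / pmf q x))"
    by (simp only: integral_map_pmf)
  also have "\<dots> = pmf_KL p q"
    by (simp only: map_fst_joint pmf_KL_def)
  finally show ?thesis .
qed

lemma set_pmf_subset_indep: "set_pmf J \<subseteq> set_pmf (indep_pmf J)"
  by (force simp: indep_pmf_def)

lemma finite_set_indep: "finite (set_pmf J) \<Longrightarrow> finite (set_pmf (indep_pmf J))"
  by (simp add: indep_pmf_def)

lemma pmf_MI_eq_KL:
  assumes fin: "finite (set_pmf J)"
  shows "pmf_MI J = pmf_KL J (indep_pmf J)"
proof -
  have "pmf_KL J (indep_pmf J) = measure_pmf.expectation J (\<lambda>w.
      - ln (pmf (map_pmf fst J) (fst w)) + - ln (pmf (map_pmf snd J) (snd w)) - (- ln (pmf J w)))"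
    unfolding pmf_KL_def indep_pmf_def
  proof (rule expectation_cong_pmf)
    fix w assume w: "w \<in> set_pmf J"
    then have "pmf (map_pmf fst J) (fst w) > 0" "pmf (map_pmf snd J) (snd w) > 0" "pmf J w > 0"
      by (auto simp: pmf_positive_iff)
    then show "ln (pmf J w / pmf (pair_pmf (map_pmf fst J) (map_pmf snd J)) w) =
      - ln (pmf (map_pmf fst J) (fst w)) + - ln (pmf (map_pmf snd J) (snd w)) - (- ln (pmf J w))"
      by (cases w) (simp add: pmf_pair ln_div ln_mult)
  qed
  also have "\<dots> = pmf_MI J"
    unfolding pmf_MI_def pmf_entropy_map unfolding pmf_entropy_def
    by (simp add: Bochner_Integration.integral_diff Bochner_Integration.integral_add
        integrable_measure_pmf_finite fin)
  finally show ?thesis ..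
qed

lemma bind_pair_pmf_kernels:
  "bind_pmf (pair_pmf p q) (\<lambda>(y, c). pair_pmf (a y) (b c)) = pair_pmf (bind_pmf p a) (bind_pmf q b)"
proof -
  have "bind_pmf q (\<lambda>c. bind_pmf (a y) (\<lambda>x. bind_pmf (b c) (\<lambda>z. return_pmf (x, z))))
     = bind_pmf (a y) (\<lambda>x. bind_pmf q (\<lambda>c. bind_pmf (b c) (\<lambda>z. return_pmf (x, z))))" for y
    by (rule bind_commute_pmf)
  then show ?thesis
    by (simp add: pair_pmf_def bind_assoc_pmf bind_return_pmf)
qed

text \<open>Processing the two components of \<open>J\<close> by separate random kernels sends the product of the
marginals to the product of the new marginals, so this is an instance of data processing for
relative entropy.\<close>

lemma pmf_MI_bind_le:
  assumes fin: "finite (set_pmf J)"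
    and fa: "\<And>y. finite (set_pmf (a y))" and fb: "\<And>c. finite (set_pmf (b c))"
  shows "pmf_MI (bind_pmf J (\<lambda>(y, c). pair_pmf (a y) (b c))) \<le> pmf_MI J"
proof -
  let ?k = "\<lambda>(y, c). pair_pmf (a y) (b c)"
  have fk: "finite (set_pmf (?k w))" for w
    using fa fb by (cases w) auto
  have m: "map_pmf fst (bind_pmf J ?k) = bind_pmf (map_pmf fst J) a"
    "map_pmf snd (bind_pmf J ?k) = bind_pmf (map_pmf snd J) b"
    by (simp_all add: map_bind_pmf bind_map_pmf split_beta map_fst_pair_pmf map_snd_pair_pmf)
  have "pmf_MI (bind_pmf J ?k) = pmf_KL (bind_pmf J ?k) (bind_pmf (indep_pmf J) ?k)"
    using fin fk by (subst pmf_MI_eq_KL) (auto simp: indep_pmf_def bind_pair_pmf_kernels m)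
  also have "\<dots> \<le> pmf_KL J (indep_pmf J)"
    by (rule pmf_KL_bind_le) (use fin fk in \<open>auto intro: finite_set_indep set_pmf_subset_indep[THEN subsetD]\<close>)
  also have "\<dots> = pmf_MI J"
    by (rule pmf_MI_eq_KL[OF fin, symmetric])
  finally show ?thesis .
qed

lemma pmf_MI_map_le:
  assumes fin: "finite (set_pmf J)"
  shows "pmf_MI (map_pmf (map_prod f g) J) \<le> pmf_MI J"
proof -
  have "map_pmf (map_prod f g) J = bind_pmf J (\<lambda>(y, c). pair_pmf (return_pmf (f y)) (return_pmf (g c)))"
    by (auto simp: map_pmf_def pair_pmf_def bind_return_pmf intro!: bind_pmf_cong)
  then show ?thesis
    using pmf_MI_bind_le[OF fin, of "\<lambda>y. return_pmf (f y)" "\<lambda>c. return_pmf (g c)"] by simp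
qed

lemma pmf_tv_nonneg: "0 \<le> pmf_tv p q"
  by (auto simp: pmf_tv_def intro!: sum_nonneg)

lemma pmf_tv_eq_sum:
  assumes "finite A" "set_pmf p \<union> set_pmf q \<subseteq> A"
  shows "pmf_tv p q = (\<Sum>x\<in>A. \<bar>pmf p x - pmf q x\<bar>) / 2"
  unfolding pmf_tv_def using assms
  by (intro arg_cong[where f="\<lambda>x. x / 2"] sum.mono_neutral_left) (auto simp: set_pmf_iff)

text \<open>A weak form of Pinsker's inequality (whose constant is smaller by a factor \<open>\<surd>2\<close>) through
the Hellinger distance \<open>h = \<Sum>x. (\<surd>p(x) - \<surd>q(x))\<^sup>2\<close>. On one hand \<open>h\<close> is at most the relative
entropy, by \<open>ln r \<le> r - 1\<close> for \<open>r = \<surd>(q/p)\<close>; on the other hand \<open>(2 tv)\<^sup>2 \<le> h (4 - h)\<close> by the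
Cauchy-Schwarz inequality for \<open>|p - q| = |\<surd>p - \<surd>q| (\<surd>p + \<surd>q)\<close>.\<close>

lemma pmf_tv_le_sqrt_KL:
  assumes fin: "finite (set_pmf q)" and ac: "set_pmf p \<subseteq> set_pmf q"
  shows "pmf_tv p q \<le> sqrt (pmf_KL p q)"
proof -
  have fp: "finite (set_pmf p)"
    using fin ac by (rule finite_subset[rotated])
  define A where "A = set_pmf q"
  define u v where "u x = sqrt (pmf p x)" and "v x = sqrt (pmf q x)" for x
  have uu: "u x * u x = pmf p x" "v x * v x = pmf q x" "0 \<le> u x" "0 \<le> v x" for x
    by (simp_all add: u_def v_def)
  have sums: "(\<Sum>x\<in>A. u x * u x) = 1" "(\<Sum>x\<in>A. v x * v x) = 1"
    unfolding uu A_def using fin ac by (auto intro: sum_pmf_eq_1)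
  define h where "h = (\<Sum>x\<in>A. (u x - v x)\<^sup>2)"
  have h: "h = 2 - 2 * (\<Sum>x\<in>A. u x * v x)"
    unfolding h_def using sums
    by (simp add: power2_diff sum.distrib sum_subtractf power2_eq_square[of "u _"]
        power2_eq_square[of "v _"] sum_distrib_left mult_ac)
  have "h \<le> pmf_KL p q"
  proof -
    have le: "2 * (1 - v x / u x) \<le> ln (pmf p x / pmf q x)" if x: "x \<in> set_pmf p" for x
    proof -
      have pos: "u x > 0" "v x > 0"
        using x ac by (auto simp: u_def v_def pmf_positive_iff)
      have "ln (v x / u x) \<le> v x / u x - 1"
        using pos by (intro ln_le_minus_one) auto
      moreover have "ln (pmf p x / pmf q x) = - 2 * ln (v x / u x)"
        unfolding uu(1,2)[symmetric] using pos by (simp add: ln_div ln_mult)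
      ultimately show ?thesis
        by simp
    qed
    have "h = 2 * (1 - (\<Sum>x\<in>set_pmf p. u x * v x))"
      unfolding h A_def using fin ac
      by (subst sum.mono_neutral_right[OF fin ac]) (auto simp: u_def set_pmf_iff)
    also have "(\<Sum>x\<in>set_pmf p. u x * v x) = measure_pmf.expectation p (\<lambda>x. v x / u x)"
      using fp
      by (subst expectation_sum_pmf[OF fp order_refl])
         (auto intro!: sum.cong simp: u_def v_def field_simps real_div_sqrt set_pmf_iff)
    also have "2 * (1 - measure_pmf.expectation p (\<lambda>x. v x / u x))
        = measure_pmf.expectation p (\<lambda>x. 2 * (1 - v x / u x))"
      using fp unfolding integral_mult_right_zero
      by (subst Bochner_Integration.integral_diff) (simp_all add: integrable_measure_pmf_finite)
    also have "\<dots> \<le> pmf_KL p q"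
      unfolding pmf_KL_def by (rule expectation_mono_pmf[OF fp le])
    finally show ?thesis .
  qed
  have "(2 * pmf_tv p q)\<^sup>2 = (\<Sum>x\<in>A. \<bar>u x - v x\<bar> * (u x + v x))\<^sup>2"
  proof -
    have "\<bar>pmf p x - pmf q x\<bar> = \<bar>u x - v x\<bar> * (u x + v x)" for x
    proof -
      have "pmf p x - pmf q x = (u x - v x) * (u x + v x)"
        unfolding uu(1,2)[symmetric] by (simp add: algebra_simps)
      then show ?thesis
        using uu(3,4)[of x] by (simp add: abs_mult)
    qed
    moreover have "2 * pmf_tv p q = (\<Sum>x\<in>A. \<bar>pmf p x - pmf q x\<bar>)"
      unfolding A_def by (subst pmf_tv_eq_sum[of "set_pmf q"]) (use fin ac in auto)
    ultimately show ?thesis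
      by (simp only:)
  qed
  also have "\<dots> \<le> (\<Sum>x\<in>A. \<bar>u x - v x\<bar>\<^sup>2) * (\<Sum>x\<in>A. (u x + v x)\<^sup>2)"
    by (rule Cauchy_Schwarz_ineq_sum)
  also have "(\<Sum>x\<in>A. \<bar>u x - v x\<bar>\<^sup>2) = h"
    by (simp add: h_def)
  also have "(\<Sum>x\<in>A. (u x + v x)\<^sup>2) = 4 - h"
    unfolding h using sums
    by (simp add: power2_sum sum.distrib power2_eq_square[of "u _"] power2_eq_square[of "v _"]
        sum_distrib_left mult_ac)
  also have "h * (4 - h) \<le> 4 * h"
    by (simp add: algebra_simps)
  finally have "(pmf_tv p q)\<^sup>2 \<le> pmf_KL p q"
    using \<open>h \<le> pmf_KL p q\<close> by (simp add: power_mult_distrib)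
  then show ?thesis
    by (rule real_le_rsqrt)
qed

lemma pmf_tv_map_le:
  assumes fin: "finite (set_pmf p)" "finite (set_pmf q)"
  shows "pmf_tv (map_pmf f p) (map_pmf f q) \<le> pmf_tv p q"
proof -
  define A where "A = set_pmf p \<union> set_pmf q"
  have fA: "finite A" using fin by (simp add: A_def)
  have pm: "pmf (map_pmf f r) z = (\<Sum>x\<in>{x\<in>A. f x = z}. pmf r x)" if "set_pmf r \<subseteq> A" for r z
  proof -
    have "pmf (map_pmf f r) z = measure r {x\<in>A. f x = z}"
      unfolding pmf_map using that
      by (intro measure_pmf.finite_measure_eq_AE) (auto simp: AE_measure_pmf_iff)
    then show ?thesis
      using fA by (simp add: measure_measure_pmf_finite)
  qed
  have "pmf_tv (map_pmf f p) (map_pmf f q)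
      = (\<Sum>z\<in>f ` A. \<bar>\<Sum>x\<in>{x\<in>A. f x = z}. pmf p x - pmf q x\<bar>) / 2"
    by (subst pmf_tv_eq_sum[of "f ` A"]) (use fin in \<open>auto simp: A_def pm[unfolded A_def] sum_subtractf\<close>)
  also have "\<dots> \<le> (\<Sum>z\<in>f ` A. \<Sum>x\<in>{x\<in>A. f x = z}. \<bar>pmf p x - pmf q x\<bar>) / 2"
    by (intro divide_right_mono sum_mono sum_abs) auto
  also have "\<dots> = pmf_tv p q"
    using fA unfolding pmf_tv_def A_def[symmetric]
    by (subst sum.image_gen[OF fA, of _ f]) auto
  finally show ?thesis .
qed

section \<open>Conditional laws and maximal couplings\<close>

lemma expectation_bind_pmf:
  fixes h :: "'b \<Rightarrow> real"
  assumes "finite (set_pmf p)" "\<And>x. x \<in> set_pmf p \<Longrightarrow> finite (set_pmf (k x))"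
  shows "measure_pmf.expectation (bind_pmf p k) h
    = measure_pmf.expectation p (\<lambda>x. measure_pmf.expectation (k x) h)"
  using assms
  by (subst pmf_expectation_bind[of "set_pmf p"])
     (auto simp: expectation_sum_pmf[OF assms(1) order_refl])

text \<open>The chain rule: entropy splits into that of the first component and the average entropy of
the second one given the first.\<close>

lemma pmf_entropy_joint:
  assumes fin: "finite (set_pmf p)" "\<And>x. x \<in> set_pmf p \<Longrightarrow> finite (set_pmf (k x))"
  shows "pmf_entropy (joint_pmf p k)
    = pmf_entropy p + measure_pmf.expectation p (\<lambda>x. pmf_entropy (k x))"
proof -
  have "pmf_entropy (joint_pmf p k) = measure_pmf.expectation p
     (\<lambda>x. measure_pmf.expectation (k x) (\<lambda>z. - ln (pmf (joint_pmf p k) (x, z))))"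
    unfolding pmf_entropy_def joint_pmf_def
    by (subst expectation_bind_pmf) (use fin in auto)
  also have "\<dots> = measure_pmf.expectation p (\<lambda>x. - ln (pmf p x) + pmf_entropy (k x))"
  proof (rule expectation_cong_pmf)
    fix x assume x: "x \<in> set_pmf p"
    have "measure_pmf.expectation (k x) (\<lambda>z. - ln (pmf (joint_pmf p k) (x, z)))
        = measure_pmf.expectation (k x) (\<lambda>z. - ln (pmf p x) + - ln (pmf (k x) z))"
      by (rule expectation_cong_pmf) (use x in \<open>auto simp: ln_mult set_pmf_iff\<close>)
    also have "\<dots> = - ln (pmf p x) + pmf_entropy (k x)"
      unfolding pmf_entropy_def using fin(2)[OF x]
      by (subst Bochner_Integration.integral_add) (auto intro: integrable_measure_pmf_finite)
    finally show "measure_pmf.expectation (k x) (\<lambda>z. - ln (pmf (joint_pmf p k) (x, z)))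
      = - ln (pmf p x) + pmf_entropy (k x)" .
  qed
  also have "\<dots> = pmf_entropy p + measure_pmf.expectation p (\<lambda>x. pmf_entropy (k x))"
    unfolding pmf_entropy_def using fin(1)
    by (subst Bochner_Integration.integral_add) (auto intro: integrable_measure_pmf_finite)
  finally show ?thesis .
qed

text \<open>The conditional law of \<open>p\<close> given that \<open>f\<close> takes the value \<open>y\<close>; meaningful only when \<open>y\<close>
has positive probability.\<close>

definition fibre_pmf :: "'a pmf \<Rightarrow> ('a \<Rightarrow> 'b) \<Rightarrow> 'b \<Rightarrow> 'a pmf" where
  "fibre_pmf p f y = cond_pmf p {x. f x = y}"

lemma set_fibre_pmf:
  "y \<in> set_pmf (map_pmf f p) \<Longrightarrow> set_pmf (fibre_pmf p f y) = {x\<in>set_pmf p. f x = y}"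
  unfolding fibre_pmf_def by (subst set_cond_pmf) auto

lemma joint_fibre_pmf:
  "joint_pmf (map_pmf f p) (\<lambda>y. map_pmf g (fibre_pmf p f y)) = map_pmf (\<lambda>x. (f x, g x)) p"
proof -
  have c: "bind_pmf (map_pmf f p) (fibre_pmf p f) = p"
    unfolding fibre_pmf_def
  proof (rule bind_cond_pmf_cancel)
    fix y x assume "y \<in> set_pmf (map_pmf f p)" "x \<in> set_pmf p" "f x = y"
    then have "{w. w = y} = {y'. f x = y'}" "f -` {y} = {x. f x = y}"
      by auto
    then show "measure p {x. f x = y} = measure (map_pmf f p) {y. f x = y}"
      using \<open>f x = y\<close> by (auto simp: vimage_def)
  qed auto
  have "map_pmf (\<lambda>x. (f x, g x)) p = map_pmf (\<lambda>x. (f x, g x)) (bind_pmf (map_pmf f p) (fibre_pmf p f))"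
    by (simp only: c)
  also have "\<dots> = joint_pmf (map_pmf f p) (\<lambda>y. map_pmf g (fibre_pmf p f y))"
    unfolding joint_pmf_def map_bind_pmf
    by (intro bind_pmf_cong refl) (auto simp: pmf.map_comp o_def set_fibre_pmf intro!: pmf.map_cong)
  finally show ?thesis ..
qed

lemma bind_fibre_pmf: "bind_pmf (map_pmf f p) (\<lambda>y. map_pmf g (fibre_pmf p f y)) = map_pmf g p"
  using arg_cong[OF joint_fibre_pmf[of f p g], of "map_pmf snd"]
  by (simp add: map_snd_joint pmf.map_comp o_def)

text \<open>Conditional entropy as an average of the entropies of the conditional laws.\<close>

lemma expectation_entropy_fibre:
  assumes fin: "finite (set_pmf p)"
  shows "measure_pmf.expectation (map_pmf f p) (\<lambda>y. pmf_entropy (map_pmf g (fibre_pmf p f y)))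
    = pmf_entropy (map_pmf (\<lambda>x. (f x, g x)) p) - pmf_entropy (map_pmf f p)"
  unfolding joint_fibre_pmf[symmetric]
  by (subst pmf_entropy_joint) (use fin in \<open>auto simp: set_fibre_pmf\<close>)

lemma pmf_tv_joint:
  assumes fin: "finite (set_pmf p)" "\<And>x. x \<in> set_pmf p \<Longrightarrow> finite (set_pmf (k x))"
    "\<And>x. x \<in> set_pmf p \<Longrightarrow> finite (set_pmf (l x))"
  shows "pmf_tv (joint_pmf p k) (joint_pmf p l)
    = measure_pmf.expectation p (\<lambda>x. pmf_tv (k x) (l x))"
proof -
  define B where "B = (\<Union>x\<in>set_pmf p. set_pmf (k x) \<union> set_pmf (l x))"
  have fB: "finite B"
    using fin by (auto simp: B_def)
  have "pmf_tv (joint_pmf p k) (joint_pmf p l)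
      = (\<Sum>w\<in>set_pmf p \<times> B. \<bar>pmf (joint_pmf p k) w - pmf (joint_pmf p l) w\<bar>) / 2"
    by (rule pmf_tv_eq_sum) (use fin fB in \<open>auto simp: joint_pmf_def B_def\<close>)
  also have "\<dots> = (\<Sum>x\<in>set_pmf p. \<Sum>z\<in>B. \<bar>pmf p x * pmf (k x) z - pmf p x * pmf (l x) z\<bar>) / 2"
    by (subst sum.cartesian_product) (auto intro!: sum.cong)
  also have "\<dots> = (\<Sum>x\<in>set_pmf p. pmf p x * pmf_tv (k x) (l x))"
    unfolding sum_divide_distrib[of _ "set_pmf p"]
  proof (rule sum.cong[OF refl])
    fix x assume x: "x \<in> set_pmf p"
    have "pmf_tv (k x) (l x) = (\<Sum>z\<in>B. \<bar>pmf (k x) z - pmf (l x) z\<bar>) / 2"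
      by (rule pmf_tv_eq_sum) (use x fB in \<open>auto simp: B_def\<close>)
    then show "(\<Sum>z\<in>B. \<bar>pmf p x * pmf (k x) z - pmf p x * pmf (l x) z\<bar>) / 2 = pmf p x * pmf_tv (k x) (l x)"
      by (simp add: right_diff_distrib[symmetric] abs_mult sum_distrib_left[symmetric])
  qed
  also have "\<dots> = measure_pmf.expectation p (\<lambda>x. pmf_tv (k x) (l x))"
    by (rule expectation_sum_pmf[OF fin(1) order_refl, symmetric])
  finally show ?thesis .
qed

text \<open>The common mass \<open>min p q\<close> is put on the diagonal. The remaining masses \<open>r = (p - q)\<^sup>+\<close> and
\<open>s = (q - p)\<^sup>+\<close> both have total \<open>d\<close>, the total variation distance, and are coupled
independently; division by zero makes that part vanish when \<open>d = 0\<close>.\<close>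

lemma maximal_coupling:
  fixes p q :: "'a pmf"
  assumes fin: "finite (set_pmf p)" "finite (set_pmf q)"
  shows "\<exists>\<gamma>. map_pmf fst \<gamma> = p \<and> map_pmf snd \<gamma> = q \<and> measure \<gamma> {(x, y). x \<noteq> y} \<le> pmf_tv p q"
proof -
  define A where "A = set_pmf p \<union> set_pmf q"
  have fA: "finite A"
    using fin by (simp add: A_def)
  have zero: "pmf p x = 0" "pmf q x = 0" if "x \<notin> A" for x
    using that by (auto simp: A_def set_pmf_iff)
  define d where "d = pmf_tv p q"
  define r s where "r x = max 0 (pmf p x - pmf q x)" and "s x = max 0 (pmf q x - pmf p x)" for x
  define f where "f w = (if fst w = snd w then min (pmf p (fst w)) (pmf q (fst w)) else 0)
      + r (fst w) * s (snd w) / d" for w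
  have d: "d = (\<Sum>x\<in>A. \<bar>pmf p x - pmf q x\<bar>) / 2"
    by (simp add: d_def pmf_tv_def A_def)
  have sums: "(\<Sum>x\<in>A. pmf p x) = 1" "(\<Sum>x\<in>A. pmf q x) = 1"
    using fA by (auto simp: A_def intro!: sum_pmf_eq_1)
  have rd: "(\<Sum>x\<in>A. r x) = d"
  proof -
    have "(\<Sum>x\<in>A. r x) = (\<Sum>x\<in>A. (\<bar>pmf p x - pmf q x\<bar> + (pmf p x - pmf q x)) / 2)"
      by (rule sum.cong) (auto simp: r_def max_def)
    then show ?thesis
      using sums by (simp add: d sum_divide_distrib[symmetric] sum.distrib sum_subtractf)
  qed
  have sd: "(\<Sum>x\<in>A. s x) = d"
  proof -
    have "(\<Sum>x\<in>A. s x) = (\<Sum>x\<in>A. (\<bar>pmf p x - pmf q x\<bar> - (pmf p x - pmf q x)) / 2)"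
      by (rule sum.cong) (auto simp: s_def max_def)
    then show ?thesis
      using sums by (simp add: d sum_divide_distrib[symmetric] sum.distrib sum_subtractf)
  qed
  have d0: "r x = 0" "s x = 0" if "d = 0" for x
  proof -
    have "(\<Sum>x\<in>A. \<bar>pmf p x - pmf q x\<bar>) = 0"
      using that d by simp
    then have "pmf p x = pmf q x"
      using fA zero by (cases "x \<in> A") (auto simp: sum_nonneg_eq_0_iff)
    then show "r x = 0" "s x = 0"
      by (auto simp: r_def s_def)
  qed
  have d_nn: "0 \<le> d"
    by (simp add: d_def pmf_tv_nonneg)
  have f_nn: "0 \<le> f w" for w
    using d_nn by (auto simp: f_def r_def s_def)
  have row: "(\<Sum>y\<in>A. f (x, y)) = pmf p x" if "x \<in> A" for x
  proof -
    have "(\<Sum>y\<in>A. f (x, y)) = min (pmf p x) (pmf q x) + r x * (\<Sum>y\<in>A. s y) / d"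
      using fA that by (simp add: f_def sum.distrib sum_distrib_left sum_divide_distrib)
    also have "r x * (\<Sum>y\<in>A. s y) / d = r x"
      using d0 by (cases "d = 0") (auto simp: sd)
    finally show ?thesis
      by (simp add: r_def)
  qed
  have col: "(\<Sum>x\<in>A. f (x, y)) = pmf q y" if "y \<in> A" for y
  proof -
    have "(\<Sum>x\<in>A. f (x, y)) = min (pmf p y) (pmf q y) + (\<Sum>x\<in>A. r x) * s y / d"
      using fA that by (simp add: f_def sum.distrib sum_distrib_right sum_divide_distrib)
    also have "(\<Sum>x\<in>A. r x) * s y / d = s y"
      using d0 by (cases "d = 0") (auto simp: rd)
    finally show ?thesis
      by (simp add: s_def)
  qed
  have out: "f w = 0" if "w \<notin> A \<times> A" for w
    using that zero by (cases w) (auto simp: f_def r_def s_def)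
  have total: "(\<integral>\<^sup>+ w. ennreal (f w) \<partial>count_space UNIV) = 1"
  proof -
    have "(\<integral>\<^sup>+ w. ennreal (f w) \<partial>count_space UNIV) = (\<Sum>w\<in>A \<times> A. ennreal (f w))"
      using fA out by (intro nn_integral_count_space') auto
    also have "\<dots> = ennreal (\<Sum>w\<in>A \<times> A. f w)"
      by (rule sum_ennreal) (rule f_nn)
    also have "(\<Sum>w\<in>A \<times> A. f w) = 1"
      using row sums by (simp add: sum.cartesian_product')
    finally show ?thesis by simp
  qed
  define \<gamma> where "\<gamma> = embed_pmf f"
  have g: "pmf \<gamma> w = f w" for w
    unfolding \<gamma>_def by (rule pmf_embed_pmf[OF f_nn total])
  have gA: "set_pmf \<gamma> \<subseteq> A \<times> A"
    by (metis g out set_pmf_iff subsetI)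
  have "map_pmf fst \<gamma> = p"
  proof (rule pmf_eqI)
    fix x
    have "pmf (map_pmf fst \<gamma>) x = measure \<gamma> ({x} \<times> A)"
      unfolding pmf_map using gA
      by (intro measure_pmf.finite_measure_eq_AE) (auto simp: AE_measure_pmf_iff)
    also have "\<dots> = (\<Sum>y\<in>A. f (x, y))"
      using fA by (subst measure_measure_pmf_finite) (auto simp: g sum.cartesian_product')
    also have "\<dots> = pmf p x"
      using row out zero by (cases "x \<in> A") auto
    finally show "pmf (map_pmf fst \<gamma>) x = pmf p x" .
  qed
  moreover have "map_pmf snd \<gamma> = q"
  proof (rule pmf_eqI)
    fix y
    have "pmf (map_pmf snd \<gamma>) y = measure \<gamma> (A \<times> {y})"
      unfolding pmf_map using gA
      by (intro measure_pmf.finite_measure_eq_AE) (auto simp: AE_measure_pmf_iff)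
    also have "\<dots> = (\<Sum>x\<in>A. f (x, y))"
      using fA by (subst measure_measure_pmf_finite) (auto simp: g sum.cartesian_product')
    also have "\<dots> = pmf q y"
      using col out zero by (cases "y \<in> A") auto
    finally show "pmf (map_pmf snd \<gamma>) y = pmf q y" .
  qed
  moreover have "measure \<gamma> {(x, y). x \<noteq> y} \<le> d"
  proof -
    have "measure \<gamma> {(x, y). x \<noteq> y} = measure \<gamma> {w\<in>A \<times> A. fst w \<noteq> snd w}"
      using gA by (intro measure_pmf.finite_measure_eq_AE) (auto simp: AE_measure_pmf_iff)
    also have "\<dots> = (\<Sum>w\<in>{w\<in>A \<times> A. fst w \<noteq> snd w}. r (fst w) * s (snd w) / d)"
      using fA by (subst measure_measure_pmf_finite) (auto simp: g f_def)
    also have "\<dots> \<le> (\<Sum>w\<in>A \<times> A. r (fst w) * s (snd w) / d)"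
      using fA d_nn by (intro sum_mono2) (auto simp: r_def s_def)
    also have "\<dots> = (\<Sum>x\<in>A. r x) * (\<Sum>y\<in>A. s y) / d"
      by (simp add: sum_product sum.cartesian_product split_beta sum_divide_distrib)
    also have "\<dots> \<le> d"
      using rd sd by simp
    finally show ?thesis .
  qed
  ultimately show ?thesis
    unfolding d_def by blast
qed

section \<open>Submodularity of entropy and dual total correlation\<close>

definition set_entropy :: "('i \<Rightarrow> 'b) pmf \<Rightarrow> 'i set \<Rightarrow> real" where
  "set_entropy p A = pmf_entropy (map_pmf (\<lambda>c. restrict c A) p)"

definition pmf_DTC :: "'i set \<Rightarrow> ('i \<Rightarrow> 'b) pmf \<Rightarrow> real" where
  "pmf_DTC I p = set_entropy p I - (\<Sum>i\<in>I. set_entropy p I - set_entropy p (I - {i}))"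

lemma restrict_eq_iff: "restrict c A = restrict c' A \<longleftrightarrow> (\<forall>i\<in>A. c i = c' i)"
  by (auto simp: fun_eq_iff restrict_def)

lemma restrict_upd_insert: "(restrict c A)(i := c i) = restrict c (insert i A)"
  by (auto simp: fun_eq_iff restrict_def)

lemma set_entropy_Un:
  "pmf_entropy (map_pmf (\<lambda>c. (restrict c A, restrict c B)) p) = set_entropy p (A \<union> B)"
  unfolding set_entropy_def by (rule pmf_entropy_map_cong) (auto simp: restrict_eq_iff)

lemma set_entropy_insert:
  "pmf_entropy (map_pmf (\<lambda>c. (restrict c A, c i)) p) = set_entropy p (insert i A)"
  unfolding set_entropy_def by (rule pmf_entropy_map_cong) (auto simp: restrict_eq_iff)

lemma set_entropy_empty [simp]: "set_entropy p {} = 0"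
proof -
  have "map_pmf (\<lambda>c. restrict c {}) p = return_pmf (\<lambda>_. undefined)"
    by (simp add: restrict_def)
  then show ?thesis
    by (simp only: set_entropy_def pmf_entropy_def expectation_return_pmf) simp
qed

text \<open>Forgetting the coordinates in \<open>B - A\<close> cannot increase the mutual information with
coordinate \<open>i\<close>.\<close>

lemma set_entropy_submodular:
  assumes fin: "finite (set_pmf p)" and sub: "A \<subseteq> B"
  shows "set_entropy p (insert i B) - set_entropy p B \<le> set_entropy p (insert i A) - set_entropy p A"
proof -
  let ?J = "\<lambda>A. map_pmf (\<lambda>c. (restrict c A, c i)) p"
  have MI: "pmf_MI (?J A) = set_entropy p A + pmf_entropy (map_pmf (\<lambda>c. c i) p) - set_entropy p (insert i A)"
    for A
    unfolding pmf_MI_def set_entropy_insert by (simp add: pmf.map_comp o_def set_entropy_def)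
  have "?J A = map_pmf (map_prod (\<lambda>c. restrict c A) (\<lambda>x. x)) (?J B)"
    using sub by (simp add: pmf.map_comp o_def Int_absorb1)
  then have "pmf_MI (?J A) \<le> pmf_MI (?J B)"
    by (simp only:) (rule pmf_MI_map_le, simp add: fin)
  then show ?thesis
    unfolding MI by simp
qed

text \<open>When the coordinates outside \<open>S\<close> are added one by one, each increment of the entropy is at
least the increment at the very end, by submodularity.\<close>

lemma sum_last_increments_le:
  assumes fin: "finite (set_pmf p)" "finite I" and sub: "S \<subseteq> I"
  shows "(\<Sum>i\<in>I - S. set_entropy p I - set_entropy p (I - {i})) \<le> set_entropy p I - set_entropy p S"
proof -
  have "(\<Sum>i\<in>T. set_entropy p I - set_entropy p (I - {i})) \<le> set_entropy p (S \<union> T) - set_entropy p S"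
    if "T \<subseteq> I - S" for T
  proof -
    have "finite T"
      using that fin(2) by (auto intro: finite_subset)
    then show ?thesis
      using that
    proof (induction T rule: finite_induct)
      case (insert i T)
      have "set_entropy p (insert i (I - {i})) - set_entropy p (I - {i})
          \<le> set_entropy p (insert i (S \<union> T)) - set_entropy p (S \<union> T)"
        by (rule set_entropy_submodular[OF fin(1)]) (use insert sub in auto)
      moreover have "insert i (I - {i}) = I"
        using insert by auto
      ultimately show ?case
        using insert by simp
    qed simp
  qed
  from this[OF order_refl] show ?thesis
    using sub by (simp add: Un_absorb1)
qed

text \<open>For the two halves \<open>S\<close> and \<open>I - S\<close>, mutual information replaces the terms \<open>H(I) - H(I -
{i})\<close> of the dual total correlation by the two larger quantities \<open>H(I) - H(S)\<close> and \<open>H(I) - H(I -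
S)\<close>.\<close>

lemma pmf_MI_split_le_DTC:
  assumes fin: "finite (set_pmf p)" "finite I" and sub: "S \<subseteq> I"
  shows "pmf_MI (map_pmf (\<lambda>c. (restrict c S, restrict c (I - S))) p) \<le> pmf_DTC I p"
proof -
  let ?h = "\<lambda>i. set_entropy p I - set_entropy p (I - {i})"
  have "pmf_MI (map_pmf (\<lambda>c. (restrict c S, restrict c (I - S))) p)
      = set_entropy p S + set_entropy p (I - S) - set_entropy p I"
    unfolding pmf_MI_def set_entropy_Un using sub
    by (simp add: pmf.map_comp o_def set_entropy_def Un_absorb1)
  moreover have "sum ?h (I - S) \<le> set_entropy p I - set_entropy p S"
    "sum ?h (I - (I - S)) \<le> set_entropy p I - set_entropy p (I - S)"
    by (rule sum_last_increments_le[OF fin]; use sub in auto)+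
  moreover have "sum ?h I = sum ?h S + sum ?h (I - S)" "I - (I - S) = S"
    using fin(2) sub by (auto simp: sum.subset_diff)
  ultimately show ?thesis
    by (simp add: pmf_DTC_def)
qed

text \<open>\<open>S\<close> is a set of largest cardinality on which \<open>F(S) = H(S) - \<Sum>i\<in>S. h\<^sub>i\<close> is at least \<open>t
|S|\<close>. A further coordinate that raised \<open>F\<close> by \<open>t\<close> or more would give a larger such set.\<close>

lemma saturated_subset:
  fixes t :: real
  assumes fin: "finite (set_pmf p)" "finite I" and t: "t > 0"
  obtains S where "S \<subseteq> I" "t * card S \<le> pmf_DTC I p"
    "\<And>i. i \<in> I - S \<Longrightarrow>
      set_entropy p (insert i S) - set_entropy p S - (set_entropy p I - set_entropy p (I - {i})) < t"
proof -
  define h where "h i = set_entropy p I - set_entropy p (I - {i})" for i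
  define F where "F S = set_entropy p S - sum h S" for S
  define \<S> where "\<S> = {S. S \<subseteq> I \<and> t * card S \<le> F S}"
  have "finite \<S>" "{} \<in> \<S>"
    using fin(2) by (auto simp: \<S>_def F_def)
  then have "Max (card ` \<S>) \<in> card ` \<S>"
    by (intro Max_in) auto
  then obtain S where S: "S \<in> \<S>" "card S = Max (card ` \<S>)"
    by auto
  have max: "card S' \<le> card S" if "S' \<in> \<S>" for S'
    using \<open>finite \<S>\<close> that by (simp add: S(2))
  have SI: "S \<subseteq> I" and SF: "t * card S \<le> F S"
    using S by (auto simp: \<S>_def)
  have fS: "finite S"
    using SI fin(2) by (rule finite_subset)
  have "F S \<le> pmf_DTC I p"
    using sum_last_increments_le[OF fin SI] sum.subset_diff[OF SI fin(2), of h]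
    by (simp add: F_def pmf_DTC_def h_def)
  moreover have "set_entropy p (insert i S) - set_entropy p S - h i < t" if i: "i \<in> I - S" for i
  proof -
    have "insert i S \<notin> \<S>"
      using max[of "insert i S"] i fS by auto
    then have "F (insert i S) < t * (card S + 1)"
      using i SI fS by (auto simp: \<S>_def)
    moreover have "F (insert i S) = F S + (set_entropy p (insert i S) - set_entropy p S - h i)"
      using i fS by (simp add: F_def)
    ultimately show ?thesis
      using SF by (simp add: algebra_simps)
  qed
  ultimately show ?thesis
    using SI SF by (intro that[of S]) (auto simp: h_def)
qed

section \<open>Coupling a law with the product of its marginals\<close>

text \<open>The coupling is built by adding one coordinate at a time. Once the coordinates in \<open>A\<close> have
been coupled, the pair of values at \<open>i\<close> comes from a maximal coupling of the conditional law of
\<open>c i\<close> given \<open>c\<close> on \<open>A\<close> with the marginal law at \<open>i\<close>. The second component of that pair has the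
same law whatever happened before, which makes the second family independent. The average
probability of disagreement at \<open>i\<close> is the total variation distance between the joint law of \<open>(c
on A, c i)\<close> and the product of its marginals; enlarging \<open>A\<close> to \<open>I - {i}\<close> removes the dependence
on the order. The default \<open>undefined\<close> of the product agrees with the value of \<^const>\<open>restrict\<close>
outside of its domain.\<close>

lemma product_coupling:
  fixes q :: "('i \<Rightarrow> 'b) pmf"
  assumes fin: "finite (set_pmf q)" "finite I"
  shows "\<exists>\<Lambda>. map_pmf fst \<Lambda> = map_pmf (\<lambda>c. restrict c I) q
    \<and> map_pmf snd \<Lambda> = Pi_pmf I undefined (\<lambda>i. map_pmf (\<lambda>c. c i) q)
    \<and> (\<forall>i\<in>I. measure \<Lambda> {(c, c'). c i \<noteq> c' i}
          \<le> (let J = map_pmf (\<lambda>c. (restrict c (I - {i}), c i)) q in pmf_tv J (indep_pmf J)))"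
proof -
  define J where "J A i = map_pmf (\<lambda>c. (restrict c A, c i)) q" for A i
  define m where "m i = map_pmf (\<lambda>c. c i) q" for i
  have fm: "finite (set_pmf (m i))" for i
    using fin by (simp add: m_def)
  \<comment> \<open>Revealing more of the other coordinates can only increase the distance from independence.\<close>
  have J_mono: "pmf_tv (J A i) (indep_pmf (J A i)) \<le> pmf_tv (J B i) (indep_pmf (J B i))"
    if "A \<subseteq> B" for A B i
  proof -
    let ?f = "map_prod (\<lambda>c. restrict c A) (\<lambda>x. x)"
    have "J A i = map_pmf ?f (J B i)"
      using that by (simp add: J_def pmf.map_comp o_def Int_absorb1)
    moreover have "indep_pmf (J A i) = map_pmf ?f (indep_pmf (J B i))"
      unfolding indep_pmf_def map_prod_def map_pair
      using that by (simp add: J_def pmf.map_comp o_def Int_absorb1)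
    ultimately show ?thesis
      by (simp only:) (rule pmf_tv_map_le, use fin in \<open>auto simp: J_def intro!: finite_set_indep\<close>)
  qed
  have "\<exists>\<Lambda>. map_pmf fst \<Lambda> = map_pmf (\<lambda>c. restrict c A) q \<and> map_pmf snd \<Lambda> = Pi_pmf A undefined m
    \<and> (\<forall>i\<in>A. measure \<Lambda> {(c, c'). c i \<noteq> c' i} \<le> pmf_tv (J (I - {i}) i) (indep_pmf (J (I - {i}) i)))"
    if "A \<subseteq> I" for A
  proof -
    have "finite A"
      using that fin(2) by (rule finite_subset)
    then show ?thesis
      using that
    proof (induction A rule: finite_induct)
      case empty
      show ?case
        by (rule exI[of _ "return_pmf (\<lambda>_. undefined, \<lambda>_. undefined)"]) (auto simp: restrict_def)
    next
      case (insert i A)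
      have "A \<subseteq> I"
        using insert.prems by simp
      from insert.IH[OF this] obtain \<Lambda> where \<Lambda>: "map_pmf fst \<Lambda> = map_pmf (\<lambda>c. restrict c A) q"
        "map_pmf snd \<Lambda> = Pi_pmf A undefined m"
        "\<And>j. j \<in> A \<Longrightarrow> measure \<Lambda> {(c, c'). c j \<noteq> c' j}
            \<le> pmf_tv (J (I - {j}) j) (indep_pmf (J (I - {j}) j))"
        by blast
      define \<nu> where "\<nu> = map_pmf (\<lambda>c. restrict c A) q"
      have fnu: "finite (set_pmf \<nu>)"
        using fin by (simp add: \<nu>_def)
      define k where "k = fibre_pmf q (\<lambda>c. restrict c A)"
      have set_k: "set_pmf (k a) = {c\<in>set_pmf q. restrict c A = a}" if "a \<in> set_pmf \<nu>" for a
        using that unfolding k_def \<nu>_def by (rule set_fibre_pmf)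
      have fk: "finite (set_pmf (k a))" if "a \<in> set_pmf \<nu>" for a
        using fin by (simp add: set_k[OF that])
      have "\<exists>\<gamma>. a \<in> set_pmf \<nu> \<longrightarrow> map_pmf fst \<gamma> = map_pmf (\<lambda>c. c i) (k a) \<and> map_pmf snd \<gamma> = m i
          \<and> measure \<gamma> {(x, y). x \<noteq> y} \<le> pmf_tv (map_pmf (\<lambda>c. c i) (k a)) (m i)" for a
        using maximal_coupling[of "map_pmf (\<lambda>c. c i) (k a)" "m i"] fk[of a] fm by auto
      then obtain \<gamma> where \<gamma>: "\<And>a. a \<in> set_pmf \<nu> \<Longrightarrow> map_pmf fst (\<gamma> a) = map_pmf (\<lambda>c. c i) (k a)"
        "\<And>a. a \<in> set_pmf \<nu> \<Longrightarrow> map_pmf snd (\<gamma> a) = m i"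
        "\<And>a. a \<in> set_pmf \<nu> \<Longrightarrow> measure (\<gamma> a) {(x, y). x \<noteq> y} \<le> pmf_tv (map_pmf (\<lambda>c. c i) (k a)) (m i)"
        by metis
      define \<Lambda>' where "\<Lambda>' = bind_pmf \<Lambda> (\<lambda>(c, c'). map_pmf (\<lambda>(u, u'). (c(i := u), c'(i := u'))) (\<gamma> c))"
      have fst_mem: "c \<in> set_pmf \<nu>" if "(c, c') \<in> set_pmf \<Lambda>" for c c'
        using that \<Lambda>(1) unfolding \<nu>_def by (metis fst_conv image_eqI set_map_pmf)
      have "map_pmf fst \<Lambda>' = bind_pmf \<Lambda> (\<lambda>w. map_pmf (\<lambda>u. (fst w)(i := u)) (map_pmf fst (\<gamma> (fst w))))"
        unfolding \<Lambda>'_def map_bind_pmf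
        by (intro bind_pmf_cong) (auto simp: pmf.map_comp o_def split_beta)
      also have "\<dots> = bind_pmf (map_pmf fst \<Lambda>) (\<lambda>a. map_pmf (\<lambda>u. a(i := u)) (map_pmf fst (\<gamma> a)))"
        by (simp add: bind_map_pmf)
      also have "\<dots> = bind_pmf \<nu> (\<lambda>a. map_pmf (\<lambda>c. restrict c (insert i A)) (k a))"
        unfolding \<Lambda>(1) \<nu>_def[symmetric]
      proof (rule bind_pmf_cong[OF refl])
        fix a assume a: "a \<in> set_pmf \<nu>"
        show "map_pmf (\<lambda>u. a(i := u)) (map_pmf fst (\<gamma> a)) = map_pmf (\<lambda>c. restrict c (insert i A)) (k a)"
          unfolding \<gamma>(1)[OF a] pmf.map_comp o_def
          by (rule pmf.map_cong) (auto simp: set_k[OF a] restrict_upd_insert)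
      qed
      also have "\<dots> = map_pmf (\<lambda>c. restrict c (insert i A)) q"
        unfolding \<nu>_def k_def by (rule bind_fibre_pmf)
      finally have 1: "map_pmf fst \<Lambda>' = map_pmf (\<lambda>c. restrict c (insert i A)) q" .
      have "map_pmf snd \<Lambda>' = bind_pmf \<Lambda> (\<lambda>w. map_pmf (\<lambda>u. (snd w)(i := u)) (map_pmf snd (\<gamma> (fst w))))"
        unfolding \<Lambda>'_def map_bind_pmf
        by (intro bind_pmf_cong) (auto simp: pmf.map_comp o_def split_beta)
      also have "\<dots> = bind_pmf \<Lambda> (\<lambda>w. map_pmf (\<lambda>u. (snd w)(i := u)) (m i))"
        by (rule bind_pmf_cong) (auto simp: \<gamma>(2)[OF fst_mem])
      also have "\<dots> = bind_pmf (map_pmf snd \<Lambda>) (\<lambda>a. map_pmf (\<lambda>u. a(i := u)) (m i))"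
        by (simp add: bind_map_pmf)
      also have "\<dots> = Pi_pmf (insert i A) undefined m"
        unfolding \<Lambda>(2) using insert(1,2)
        by (subst Pi_pmf_insert') (auto simp: map_pmf_def intro: bind_commute_pmf)
      finally have 2: "map_pmf snd \<Lambda>' = Pi_pmf (insert i A) undefined m" .
      have m\<Lambda>': "measure \<Lambda>' X
          = measure_pmf.expectation \<Lambda> (\<lambda>(c, c'). measure (\<gamma> c) {(u, u'). (c(i := u), c'(i := u')) \<in> X})" for X
        unfolding \<Lambda>'_def measure_pmf_bind
        by (subst measure_pmf.measure_bind[where N = "count_space UNIV"])
           (auto simp: vimage_def split_beta measure_pmf_in_subprob_algebra intro!: Bochner_Integration.integral_cong arg_cong[where f = "measure _"])
      have "measure \<Lambda>' {(c, c'). c j \<noteq> c' j} \<le> pmf_tv (J (I - {j}) j) (indep_pmf (J (I - {j}) j))"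
        if j: "j \<in> insert i A" for j
      proof (cases "j = i")
        case False
        have "measure \<Lambda>' {(c, c'). c j \<noteq> c' j} = measure_pmf.expectation \<Lambda> (indicator {(c, c'). c j \<noteq> c' j})"
          unfolding m\<Lambda>' using False
          by (intro Bochner_Integration.integral_cong) (auto simp: indicator_def)
        also have "\<dots> = measure \<Lambda> {(c, c'). c j \<noteq> c' j}"
          by simp
        finally show ?thesis
          using \<Lambda>(3)[of j] False j by simp
      next
        case True
        have "measure \<Lambda>' {(c, c'). c i \<noteq> c' i} = measure_pmf.expectation \<Lambda> (\<lambda>w. measure (\<gamma> (fst w)) {(u, u'). u \<noteq> u'})"
          unfolding m\<Lambda>' by (intro Bochner_Integration.integral_cong) auto
        also have "\<dots> = measure_pmf.expectation \<nu> (\<lambda>a. measure (\<gamma> a) {(u, u'). u \<noteq> u'})"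
          unfolding \<nu>_def \<Lambda>(1)[symmetric] by simp
        also have "\<dots> \<le> measure_pmf.expectation \<nu> (\<lambda>a. pmf_tv (map_pmf (\<lambda>c. c i) (k a)) (m i))"
          by (rule expectation_mono_pmf[OF fnu \<gamma>(3)])
        also have "\<dots> = pmf_tv (joint_pmf \<nu> (\<lambda>a. map_pmf (\<lambda>c. c i) (k a))) (joint_pmf \<nu> (\<lambda>_. m i))"
          by (rule pmf_tv_joint[symmetric]) (use fnu fk fm in auto)
        also have "joint_pmf \<nu> (\<lambda>a. map_pmf (\<lambda>c. c i) (k a)) = J A i"
          unfolding \<nu>_def k_def J_def by (rule joint_fibre_pmf)
        also have "joint_pmf \<nu> (\<lambda>_. m i) = indep_pmf (J A i)"
        proof -
          have "indep_pmf (J A i) = pair_pmf \<nu> (m i)"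
            by (simp add: indep_pmf_def J_def \<nu>_def m_def pmf.map_comp o_def)
          also have "\<dots> = joint_pmf \<nu> (\<lambda>_. m i)"
            by (simp add: joint_pmf_def pair_pmf_def map_pmf_def)
          finally show ?thesis ..
        qed
        also have "pmf_tv (J A i) (indep_pmf (J A i)) \<le> pmf_tv (J (I - {i}) i) (indep_pmf (J (I - {i}) i))"
          by (rule J_mono) (use insert in auto)
        finally show ?thesis
          using True by simp
      qed
      then show ?case
        using 1 2 by blast
    qed
  qed
  from this[OF order_refl] show ?thesis
    by (simp add: J_def m_def[abs_def] Let_def)
qed

lemma expectation_fibre_set_entropy:
  assumes fin: "finite (set_pmf p)"
    and g: "\<And>c c'. g c = g c' \<longleftrightarrow> restrict c B = restrict c' B"
  shows "measure_pmf.expectation (map_pmf (\<lambda>c. restrict c S) p)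
      (\<lambda>y. pmf_entropy (map_pmf g (fibre_pmf p (\<lambda>c. restrict c S) y)))
    = set_entropy p (S \<union> B) - set_entropy p S"
proof -
  have "pmf_entropy (map_pmf (\<lambda>c. (restrict c S, g c)) p) = set_entropy p (S \<union> B)"
    unfolding set_entropy_def
    by (rule pmf_entropy_map_cong) (auto simp: g restrict_eq_iff)
  then show ?thesis
    unfolding expectation_entropy_fibre[OF fin] by (simp add: set_entropy_def)
qed

text \<open>The small quantity is the mutual information of \<open>c i\<close> and the other coordinates given
those in \<open>S\<close>, that is, the average of the mutual informations \<open>x\<close> in the fibres. In each fibre
the distance is at most \<open>\<surd>x \<le> (x + s\<^sup>2) / (2 s)\<close>, and this bound is linear in \<open>x\<close>, so that it
can be averaged.\<close>

lemma expectation_tv_le: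
  fixes p :: "('i \<Rightarrow> 'b) pmf" and s :: real
  assumes fin: "finite (set_pmf p)" and i: "i \<in> I - S" and S: "S \<subseteq> I" and s: "s > 0"
    and small: "set_entropy p (insert i S) - set_entropy p S
      - (set_entropy p I - set_entropy p (I - {i})) \<le> s\<^sup>2"
  shows "measure_pmf.expectation (map_pmf (\<lambda>c. restrict c S) p)
     (\<lambda>y. let J = map_pmf (\<lambda>c. (restrict c (I - {i}), c i)) (fibre_pmf p (\<lambda>c. restrict c S) y)
          in pmf_tv J (indep_pmf J)) \<le> s"
proof -
  define f where "f c = restrict c S" for c :: "'i \<Rightarrow> 'b"
  define \<nu> where "\<nu> = map_pmf f p"
  define J where "J y = map_pmf (\<lambda>c. (restrict c (I - {i}), c i)) (fibre_pmf p f y)" for y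
  have fnu: "finite (set_pmf \<nu>)"
    using fin by (simp add: \<nu>_def)
  have fJ: "finite (set_pmf (J y))" if "y \<in> set_pmf \<nu>" for y
    using fin that by (simp add: J_def \<nu>_def set_fibre_pmf)
  have int: "integrable \<nu> g" for g :: "_ \<Rightarrow> real"
    by (rule integrable_measure_pmf_finite[OF fnu])
  have "measure_pmf.expectation \<nu> (\<lambda>y. pmf_MI (J y)) =
      measure_pmf.expectation \<nu> (\<lambda>y. pmf_entropy (map_pmf (\<lambda>c. restrict c (I - {i})) (fibre_pmf p f y)))
    + measure_pmf.expectation \<nu> (\<lambda>y. pmf_entropy (map_pmf (\<lambda>c. c i) (fibre_pmf p f y)))
    - measure_pmf.expectation \<nu> (\<lambda>y. pmf_entropy (J y))"
    unfolding pmf_MI_def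
    by (simp add: Bochner_Integration.integral_diff Bochner_Integration.integral_add int
        J_def pmf.map_comp o_def)
  also have "\<dots> = (set_entropy p (S \<union> (I - {i})) - set_entropy p S)
      + (set_entropy p (S \<union> {i}) - set_entropy p S) - (set_entropy p (S \<union> I) - set_entropy p S)"
    unfolding J_def \<nu>_def f_def
    by (intro arg_cong2[where f = "(+)"] arg_cong2[where f = "(-)"]
          expectation_fibre_set_entropy[OF fin])
       (use i in \<open>auto simp: restrict_eq_iff\<close>)
  also have "\<dots> \<le> s\<^sup>2"
  proof -
    have "S \<union> (I - {i}) = I - {i}" "S \<union> I = I" "S \<union> {i} = insert i S"
      using i S by auto
    then show ?thesis
      using small by simp
  qed
  finally have MI: "measure_pmf.expectation \<nu> (\<lambda>y. pmf_MI (J y)) \<le> s\<^sup>2" .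
  have tv: "pmf_tv (J y) (indep_pmf (J y)) \<le> (pmf_MI (J y) + s\<^sup>2) / (2 * s)" if y: "y \<in> set_pmf \<nu>" for y
  proof -
    define d where "d = pmf_tv (J y) (indep_pmf (J y))"
    have "d \<le> sqrt (pmf_MI (J y))"
      unfolding d_def pmf_MI_eq_KL[OF fJ[OF y]]
      by (rule pmf_tv_le_sqrt_KL[OF finite_set_indep[OF fJ[OF y]] set_pmf_subset_indep])
    moreover have "0 \<le> d"
      by (simp add: d_def pmf_tv_nonneg)
    ultimately have "d\<^sup>2 \<le> pmf_MI (J y)"
      by (metis dual_order.trans real_sqrt_ge_0_iff real_sqrt_pow2 power_mono)
    moreover have "2 * s * d \<le> d\<^sup>2 + s\<^sup>2"
      using sum_squares_bound[of s d] by (simp add: add.commute)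
    ultimately have "d * (2 * s) \<le> pmf_MI (J y) + s\<^sup>2"
      by (simp add: mult.commute)
    then show ?thesis
      using s by (simp add: d_def pos_le_divide_eq)
  qed
  have "measure_pmf.expectation \<nu> (\<lambda>y. pmf_tv (J y) (indep_pmf (J y)))
      \<le> measure_pmf.expectation \<nu> (\<lambda>y. (pmf_MI (J y) + s\<^sup>2) / (2 * s))"
    by (rule expectation_mono_pmf[OF fnu tv])
  also have "\<dots> = (measure_pmf.expectation \<nu> (\<lambda>y. pmf_MI (J y)) + s\<^sup>2) / (2 * s)"
    by (simp add: Bochner_Integration.integral_add int)
  also have "\<dots> \<le> (s\<^sup>2 + s\<^sup>2) / (2 * s)"
    using MI s by (intro divide_right_mono) auto
  also have "\<dots> = s"
    using s by (simp add: power2_eq_square)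
  finally show ?thesis
    by (simp add: \<nu>_def J_def f_def[abs_def] Let_def)
qed

section \<open>Entropies of finite-valued random variables\<close>

text \<open>The distribution of a finite-valued random variable as a \<^typ>\<open>'b pmf\<close>; this translates the
entropies of random variables on \<open>M\<close> into entropies of probability mass functions.\<close>

definition law :: "'w measure \<Rightarrow> ('w \<Rightarrow> 'b) \<Rightarrow> 'b pmf" where
  "law M X = Abs_pmf (distr M (count_space UNIV) X)"

context prob_space
begin

lemma measure_pmf_law:
  assumes X: "simple_function M X"
  shows "measure_pmf (law M X) = distr M (count_space UNIV) X"
  unfolding law_def
proof (rule Abs_pmf_inverse, safe)
  note [measurable] = measurable_simple_function[OF X]
  show "prob_space (distr M (count_space UNIV) X)"
    by (rule prob_space_distr) measurable
  have fin: "finite (X ` space M)"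
    using X by (rule simple_functionD)
  have "AE w in M. X w \<noteq> x" if "prob (X -` {x} \<inter> space M) = 0" for x
  proof -
    have "AE w in M. w \<notin> X -` {x} \<inter> space M"
      using that by (subst (asm) prob_eq_0) (auto intro: measurable_sets[of X M "count_space UNIV"])
    then show ?thesis
      by (rule AE_mp) (auto intro!: AE_I2)
  qed
  then have "AE w in M. \<forall>x\<in>X ` space M. prob (X -` {x} \<inter> space M) = 0 \<longrightarrow> X w \<noteq> x"
    using fin by (subst AE_finite_all) auto
  then have "AE w in M. prob (X -` {X w} \<inter> space M) \<noteq> 0"
    by (rule AE_mp) (auto intro!: AE_I2)
  then show "AE x in distr M (count_space UNIV) X. measure (distr M (count_space UNIV) X) {x} \<noteq> 0"
    by (simp add: AE_distr_iff measure_distr)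
qed auto

lemma measure_law:
  assumes "simple_function M X"
  shows "measure (law M X) A = measure M {w\<in>space M. X w \<in> A}"
  unfolding measure_pmf_law[OF assms]
  by (subst measure_distr)
     (auto intro: measurable_simple_function assms arg_cong[where f = "measure M"])

lemma set_law_subset:
  assumes X: "simple_function M X"
  shows "set_pmf (law M X) \<subseteq> X ` space M"
proof
  fix x assume "x \<in> set_pmf (law M X)"
  then have "measure (law M X) {x} \<noteq> 0"
    by (simp add: set_pmf_iff measure_pmf_single)
  then have "{w\<in>space M. X w \<in> {x}} \<noteq> {}"
    unfolding measure_law[OF X] by (metis measure_empty)
  then show "x \<in> X ` space M"
    by auto
qed

lemma finite_set_law: "simple_function M X \<Longrightarrow> finite (set_pmf (law M X))"
  using set_law_subset[of X] simple_functionD(1)[of M X] by (rule finite_subset)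

lemma law_comp:
  assumes X: "simple_function M X"
  shows "law M (\<lambda>w. f (X w)) = map_pmf f (law M X)"
proof -
  have fX: "simple_function M (\<lambda>w. f (X w))"
    using simple_function_compose[OF X, of f] by (simp add: o_def)
  show ?thesis
    by (rule pmf_eqI) (simp add: pmf.rep_eq[of "law M _"] pmf_map measure_law[OF X] measure_law[OF fX])
qed

lemma Ent_eq_pmf_entropy:
  assumes X: "simple_function M X"
  shows "Ent M X = pmf_entropy (law M X)"
proof -
  interpret information_space M "exp 1"
    by unfold_locales simp
  have m: "measure M (X -` {x} \<inter> space M) = pmf (law M X) x" for x
    by (auto simp: pmf.rep_eq measure_law[OF X] intro!: arg_cong[where f = "measure M"])
  have "Ent M X = - (\<Sum>x\<in>X ` space M. pmf (law M X) x * ln (pmf (law M X) x))"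
    unfolding Ent_def
    by (subst entropy_simple_distributed[OF simple_distributedI[OF X measure_nonneg refl]])
       (simp add: m log_def)
  also have "\<dots> = pmf_entropy (law M X)"
    unfolding pmf_entropy_def
    by (subst expectation_sum_pmf[OF _ set_law_subset[OF X]])
       (auto simp: sum_negf simple_functionD(1)[OF X])
  finally show ?thesis .
qed

lemma Ent_comp:
  assumes Z: "simple_function M Z"
  shows "Ent M (\<lambda>w. f (Z w)) = pmf_entropy (map_pmf f (law M Z))"
  unfolding law_comp[OF Z, symmetric]
  using simple_function_compose[OF Z, of f] by (intro Ent_eq_pmf_entropy) (simp add: o_def)

lemma cond_Ent_eq:
  assumes X: "simple_function M X" and Y: "simple_function M Y"
  shows "cond_Ent M X Y = Ent M (\<lambda>w. (Y w, X w)) - Ent M Y"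
proof -
  interpret information_space M "exp 1"
    by unfold_locales simp
  show ?thesis
    unfolding cond_Ent_def Ent_def by (simp add: entropy_chain_rule[OF Y X])
qed

lemma finite_mutual_info_eq_pmf_MI:
  assumes XY: "simple_function M (\<lambda>w. (X w, Y w))"
  shows "finite_mutual_info M X Y = pmf_MI (law M (\<lambda>w. (X w, Y w)))"
proof -
  have X: "simple_function M X" and Y: "simple_function M Y"
    using simple_function_compose[OF XY, of fst] simple_function_compose[OF XY, of snd]
    by (simp_all add: o_def)
  show ?thesis
    unfolding finite_mutual_info_def pmf_MI_def Ent_eq_pmf_entropy[OF XY] Ent_eq_pmf_entropy[OF X]
      Ent_eq_pmf_entropy[OF Y]
    by (simp add: law_comp[OF XY, symmetric])
qed

lemma simple_function_PiE:
  assumes fin: "finite I" and X: "\<And>i. i \<in> I \<Longrightarrow> simple_function M (X i)"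
  shows "simple_function M (\<lambda>w. \<lambda>i\<in>I. X i w)"
  unfolding simple_function_def
proof (intro conjI ballI)
  have "(\<lambda>w. \<lambda>i\<in>I. X i w) ` space M \<subseteq> (\<Pi>\<^sub>E i\<in>I. X i ` space M)"
    by auto
  then show "finite ((\<lambda>w. \<lambda>i\<in>I. X i w) ` space M)"
    by (rule finite_subset) (use fin X in \<open>auto intro!: finite_PiE dest: simple_functionD(1)\<close>)
next
  fix c assume c: "c \<in> (\<lambda>w. \<lambda>i\<in>I. X i w) ` space M"
  have "(\<lambda>w. \<lambda>i\<in>I. X i w) -` {c} \<inter> space M = {w\<in>space M. \<forall>i\<in>I. X i w = c i}"
    using c by (auto simp: restrict_eq_iff)
  also have "\<dots> \<in> sets M"
  proof (rule sets.sets_Collect_finite_All[OF _ fin])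
    fix i assume "i \<in> I"
    then have "X i -` {c i} \<inter> space M \<in> sets M"
      by (intro simple_functionD X)
    then show "{w \<in> space M. X i w = c i} \<in> sets M"
      by (simp add: vimage_def Int_def conj_commute)
  qed
  finally show "(\<lambda>w. \<lambda>i\<in>I. X i w) -` {c} \<inter> space M \<in> sets M" .
qed

lemma finite_DTC_eq_pmf_DTC:
  assumes fin: "finite I" and X: "\<And>i. i \<in> I \<Longrightarrow> simple_function M (X i)"
  shows "finite_DTC M I X = pmf_DTC I (law M (\<lambda>w. \<lambda>i\<in>I. X i w))"
proof -
  define Z where "Z w = (\<lambda>i\<in>I. X i w)" for w
  have Z: "simple_function M Z"
    unfolding Z_def by (rule simple_function_PiE[OF fin X])
  define p where "p = law M Z"
  have Z_restrict: "(\<lambda>w. \<lambda>j\<in>A. X j w) = (\<lambda>w. restrict (Z w) A)" if "A \<subseteq> I" for A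
    using that by (auto simp: Z_def fun_eq_iff restrict_def)
  have H: "Ent M (\<lambda>w. \<lambda>j\<in>A. X j w) = set_entropy p A" if "A \<subseteq> I" for A
    unfolding Z_restrict[OF that] set_entropy_def p_def by (rule Ent_comp[OF Z])
  have "cond_Ent M (X i) (\<lambda>w. \<lambda>j\<in>I - {i}. X j w) = set_entropy p I - set_entropy p (I - {i})"
    if i: "i \<in> I" for i
  proof -
    have "cond_Ent M (X i) (\<lambda>w. \<lambda>j\<in>I - {i}. X j w)
        = Ent M (\<lambda>w. (\<lambda>j\<in>I - {i}. X j w, X i w)) - Ent M (\<lambda>w. \<lambda>j\<in>I - {i}. X j w)"
      by (rule cond_Ent_eq) (use fin X i in \<open>auto intro!: simple_function_PiE\<close>)
    also have "Ent M (\<lambda>w. (\<lambda>j\<in>I - {i}. X j w, X i w)) = Ent M (\<lambda>w. (\<lambda>c. (restrict c (I - {i}), c i)) (Z w))"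
      using i fun_cong[OF Z_restrict[of "I - {i}"]] by (simp add: Z_def)
    also have "\<dots> = set_entropy p (insert i (I - {i}))"
      unfolding set_entropy_insert[symmetric] p_def by (rule Ent_comp[OF Z])
    also have "insert i (I - {i}) = I"
      using i by auto
    finally show ?thesis
      by (simp only: H[OF Diff_subset])
  qed
  then show ?thesis
    unfolding finite_DTC_def pmf_DTC_def H[OF order_refl] by (simp add: p_def Z_def[abs_def])
qed

end

section \<open>Quantization and partitions into small cells\<close>

lemma quantize_eqI:
  assumes P: "partition_on A P" and C: "C \<in> P" "x \<in> C"
  shows "quantize P x = C"
  unfolding quantize_def
proof (rule the_equality)
  fix D assume "D \<in> P \<and> x \<in> D"
  then show "D = C"
    using partition_onD2[OF P] C by (auto simp: disjoint_def)
qed (use C in auto)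

lemma quantize_mem:
  assumes "partition_on A P" "x \<in> A"
  shows "quantize P x \<in> P" "x \<in> quantize P x"
proof -
  obtain C where "C \<in> P" "x \<in> C"
    using partition_onD1[OF assms(1)] assms(2) by auto
  then show "quantize P x \<in> P" "x \<in> quantize P x"
    using quantize_eqI[OF assms(1)] by auto
qed

lemma simple_function_quantize:
  assumes P: "P \<in> finite_partitions K" and X: "X \<in> M \<rightarrow>\<^sub>M K"
  shows "simple_function M (\<lambda>w. quantize P (X w))"
  unfolding simple_function_def
proof (intro conjI ballI)
  have part: "partition_on (space K) P" and fin: "finite P" and sets: "P \<subseteq> sets K"
    using P by (auto simp: finite_partitions_def)
  have mem: "X w \<in> space K" if "w \<in> space M" for w
    using X that by (rule measurable_space)
  have sub: "(\<lambda>w. quantize P (X w)) ` space M \<subseteq> P"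
    using quantize_mem(1)[OF part mem] by auto
  then show "finite ((\<lambda>w. quantize P (X w)) ` space M)"
    using fin by (rule finite_subset)
  fix C assume "C \<in> (\<lambda>w. quantize P (X w)) ` space M"
  then have C: "C \<in> P"
    using sub by auto
  have "(\<lambda>w. quantize P (X w)) -` {C} \<inter> space M = X -` C \<inter> space M"
    using quantize_mem(2)[OF part mem] quantize_eqI[OF part C] by auto
  then show "(\<lambda>w. quantize P (X w)) -` {C} \<inter> space M \<in> sets M"
    using measurable_sets[OF X, of C] C sets by auto
qed

text \<open>Balls of radius \<open>\<epsilon>/2\<close> around a countable dense set cover the space. The first \<open>N\<close> of them,
made disjoint, are the good cells \<open>G\<close>, and continuity of the measure makes the remaining cell
have small mass for large \<open>N\<close>.\<close>

lemma exists_small_partition: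
  fixes K :: "'a metric"
  assumes sep: "separable_space (mtopology_of K)"
    and \<eta>: "prob_space \<eta>" "sets \<eta> = sets (borel_of (mtopology_of K))"
    and \<epsilon>: "\<epsilon> > 0"
  shows "\<exists>P\<in>finite_partitions (borel_of (mtopology_of K)). \<exists>G\<subseteq>P.
    (\<forall>C\<in>G. \<forall>x\<in>C. \<forall>y\<in>C. mdist K x y \<le> \<epsilon>) \<and> measure \<eta> (mspace K - \<Union>G) \<le> \<epsilon>"
proof -
  interpret \<eta>: prob_space \<eta> by (rule \<eta>(1))
  interpret Metric_space "mspace K" "mdist K"
    by (rule Metric_space_mspace_mdist)
  let ?B = "borel_of (mtopology_of K)"
  have sp: "space \<eta> = mspace K"
    using sets_eq_imp_space_eq[OF \<eta>(2)] by simp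
  obtain D where D: "countable D" "D \<subseteq> mspace K" "mtopology closure_of D = mspace K"
    using sep unfolding separable_space_def mtopology_of_def by auto
  have "mspace K \<noteq> {}"
    using \<eta>.not_empty by (simp add: sp)
  then have "D \<noteq> {}"
    using D(3) by auto
  define c where "c = from_nat_into D"
  have c: "range c = D"
    unfolding c_def using \<open>D \<noteq> {}\<close> D(1) by (rule range_from_nat_into)
  define U where "U k = mball (c k) (\<epsilon> / 2)" for k
  have U_sets: "U k \<in> sets ?B" for k
    unfolding U_def by (rule borel_of_open) (simp add: mtopology_of_def openin_mball)
  have cover: "(\<Union>k. U k) = mspace K"
  proof
    show "mspace K \<subseteq> (\<Union>k. U k)"
    proof
      fix x assume "x \<in> mspace K"
      then have "x \<in> mtopology closure_of D"
        using D(3) by simp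
      then obtain d where "d \<in> D" "d \<in> mball x (\<epsilon> / 2)"
        unfolding metric_closure_of using \<epsilon> by (auto simp del: in_mball) (metis half_gt_zero)
      then show "x \<in> (\<Union>k. U k)"
        using c by (auto simp: U_def commute)
    qed
  qed (auto simp: U_def)
  define E where "E = disjointed U"
  have E_sets: "E k \<in> sets ?B" for k
    using sets.range_disjointed_sets[of U ?B] U_sets by (auto simp: E_def)
  have "(\<lambda>N. measure \<eta> (\<Union>k<N. U k)) \<longlonglongrightarrow> measure \<eta> (\<Union>N. \<Union>k<N. U k)"
  proof (rule \<eta>.finite_Lim_measure_incseq)
    show "incseq (\<lambda>N. \<Union>k<N. U k)"
      unfolding incseq_def by (intro allI impI UN_mono) auto
  qed (use U_sets \<eta>(2) in auto)
  also have "(\<Union>N. \<Union>k<N. U k) = space \<eta>"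
    using cover by (auto simp: sp)
  finally have "(\<lambda>N. measure \<eta> (\<Union>k<N. U k)) \<longlonglongrightarrow> 1"
    by (simp add: \<eta>.prob_space)
  then have "\<forall>\<^sub>F N in sequentially. 1 - \<epsilon> < measure \<eta> (\<Union>k<N. U k)"
    by (rule order_tendstoD) (use \<epsilon> in auto)
  then obtain N where N: "1 - \<epsilon> < measure \<eta> (\<Union>k<N. U k)"
    by (auto simp: eventually_sequentially)
  have UE: "(\<Union>k<N. E k) = (\<Union>k<N. U k)"
    unfolding E_def by (simp add: lessThan_atLeast0 finite_UN_disjointed_eq)
  define R where "R = mspace K - (\<Union>k<N. E k)"
  have "mspace K \<in> sets ?B"
    using sets.top[of ?B] by simp
  then have R_sets: "R \<in> sets ?B"
    unfolding R_def using E_sets by auto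
  define G where "G = E ` {..<N} - {{}}"
  define P where "P = insert R (E ` {..<N}) - {{}}"
  have un: "\<Union>(A - {{}}) = \<Union>A" for A :: "'a set set"
    by auto
  have UG: "\<Union>G = (\<Union>k<N. U k)"
    unfolding G_def un UE[symmetric] by simp
  have E_eq: "k = l" if "x \<in> E k" "x \<in> E l" for k l x
    using disjoint_family_disjointed[of U] that by (auto simp: E_def disjoint_family_on_def)
  have "disjoint P"
    by (auto simp: P_def R_def disjoint_def dest: E_eq)
  moreover have "\<Union>P = mspace K"
    unfolding P_def R_def un Union_insert using cover UE by blast
  ultimately have "P \<in> finite_partitions ?B"
    unfolding finite_partitions_def partition_on_def
    using E_sets R_sets by (auto simp: P_def)
  moreover have "G \<subseteq> P"
    by (auto simp: G_def P_def)
  moreover have "mdist K x y \<le> \<epsilon>" if "C \<in> G" "x \<in> C" "y \<in> C" for C x y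
  proof -
    from that obtain k where "x \<in> E k" "y \<in> E k"
      by (auto simp: G_def)
    then have k: "x \<in> U k" "y \<in> U k"
      using disjointed_subset[of U k] by (auto simp: E_def)
    then have "mdist K x y \<le> mdist K x (c k) + mdist K (c k) y"
      by (intro triangle) (auto simp: U_def)
    then show ?thesis
      using k by (simp add: U_def commute[of x])
  qed
  moreover have "measure \<eta> (mspace K - \<Union>G) \<le> \<epsilon>"
    using N U_sets unfolding UG by (subst sp[symmetric], subst \<eta>.prob_compl) (auto simp: \<eta>(2))
  ultimately show ?thesis
    by blast
qed

section \<open>Finite mixtures of probability measures\<close>

lemma prob_algebraD:
  assumes "M \<in> space (prob_algebra N)"
  shows "prob_space M" "sets M = sets N" "space M = space N"
  using assms by (auto simp: space_prob_algebra dest: sets_eq_imp_space_eq)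

lemma measurable_kernel_pmf:
  assumes "\<And>x. m x \<in> space (prob_algebra N)"
  shows "m \<in> measure_pmf q \<rightarrow>\<^sub>M subprob_algebra N"
  using assms
  by (auto simp: space_prob_algebra space_subprob_algebra prob_space_imp_subprob_space)

lemma emeasure_bind_kernel:
  assumes "\<And>x. m x \<in> space (prob_algebra N)" "A \<in> sets N"
  shows "emeasure (measure_pmf q \<bind> m) A = (\<integral>\<^sup>+x. emeasure (m x) A \<partial>q)"
  by (rule emeasure_bind[OF _ measurable_kernel_pmf assms(2)]) (use assms in auto)

lemma bind_kernel_prob_algebra:
  assumes "\<And>x. m x \<in> space (prob_algebra N)"
  shows "measure_pmf q \<bind> m \<in> space (prob_algebra N)"
proof -
  have "prob_space (measure_pmf q \<bind> m)"
    by (rule measure_pmf.prob_space_bind[OF _ measurable_kernel_pmf])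
       (use assms in \<open>auto dest: prob_algebraD\<close>)
  moreover have "sets (measure_pmf q \<bind> m) = sets N"
    using assms by (intro sets_bind) (auto dest: prob_algebraD)
  ultimately show ?thesis
    by (simp add: space_prob_algebra)
qed

lemma bind_kernel_cong:
  assumes f: "\<And>x. f x \<in> space (prob_algebra N)" and g: "\<And>x. g x \<in> space (prob_algebra N)"
    and eq: "\<And>x. x \<in> set_pmf q \<Longrightarrow> f x = g x"
  shows "measure_pmf q \<bind> f = measure_pmf q \<bind> g"
proof (rule measure_eqI)
  have sf: "sets (measure_pmf q \<bind> f) = sets N"
    by (rule prob_algebraD(2)[OF bind_kernel_prob_algebra]) (rule f)
  have sg: "sets (measure_pmf q \<bind> g) = sets N"
    by (rule prob_algebraD(2)[OF bind_kernel_prob_algebra]) (rule g)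
  show "sets (measure_pmf q \<bind> f) = sets (measure_pmf q \<bind> g)"
    by (simp only: sf sg)
  fix A assume "A \<in> sets (measure_pmf q \<bind> f)"
  then have A: "A \<in> sets N"
    by (simp only: sf)
  show "emeasure (measure_pmf q \<bind> f) A = emeasure (measure_pmf q \<bind> g) A"
    unfolding emeasure_bind_kernel[OF f A] emeasure_bind_kernel[OF g A]
    by (rule nn_integral_cong_AE) (simp add: AE_measure_pmf_iff eq)
qed

lemma bind_pmf_kernel:
  assumes m: "\<And>c. m c \<in> space (prob_algebra N)"
  shows "measure_pmf (bind_pmf p k) \<bind> m = measure_pmf p \<bind> (\<lambda>y. measure_pmf (k y) \<bind> m)"
proof (rule measure_eqI)
  have km: "measure_pmf (k y) \<bind> m \<in> space (prob_algebra N)" for y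
    by (rule bind_kernel_prob_algebra[OF m])
  have 1: "sets (measure_pmf (bind_pmf p k) \<bind> m) = sets N"
    by (rule prob_algebraD(2)[OF bind_kernel_prob_algebra[OF m]])
  have 2: "sets (measure_pmf p \<bind> (\<lambda>y. measure_pmf (k y) \<bind> m)) = sets N"
    by (rule prob_algebraD(2)[OF bind_kernel_prob_algebra[OF km]])
  show "sets (measure_pmf (bind_pmf p k) \<bind> m) = sets (measure_pmf p \<bind> (\<lambda>y. measure_pmf (k y) \<bind> m))"
    by (simp only: 1 2)
  fix A assume "A \<in> sets (measure_pmf (bind_pmf p k) \<bind> m)"
  then have A: "A \<in> sets N" by (simp only: 1)
  show "emeasure (measure_pmf (bind_pmf p k) \<bind> m) A
      = emeasure (measure_pmf p \<bind> (\<lambda>y. measure_pmf (k y) \<bind> m)) A"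
    by (simp add: emeasure_bind_kernel[OF m A] emeasure_bind_kernel[OF km A])
qed

lemma map_pmf_kernel:
  assumes m: "\<And>c. m c \<in> space (prob_algebra N)"
  shows "measure_pmf (map_pmf f p) \<bind> m = measure_pmf p \<bind> (\<lambda>y. m (f y))"
proof (rule measure_eqI)
  have 1: "sets (measure_pmf (map_pmf f p) \<bind> m) = sets N"
    by (rule prob_algebraD(2)[OF bind_kernel_prob_algebra[OF m]])
  have 2: "sets (measure_pmf p \<bind> (\<lambda>y. m (f y))) = sets N"
    by (rule prob_algebraD(2)[OF bind_kernel_prob_algebra[OF m]])
  show "sets (measure_pmf (map_pmf f p) \<bind> m) = sets (measure_pmf p \<bind> (\<lambda>y. m (f y)))"
    by (simp only: 1 2)
  fix A assume "A \<in> sets (measure_pmf (map_pmf f p) \<bind> m)"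
  then have A: "A \<in> sets N" by (simp only: 1)
  show "emeasure (measure_pmf (map_pmf f p) \<bind> m) A = emeasure (measure_pmf p \<bind> (\<lambda>y. m (f y))) A"
    by (simp add: emeasure_bind_kernel[OF m A] emeasure_bind_kernel[OF m[of "f _"] A])
qed

text \<open>\<open>M\<close> conditioned on \<open>Z = c\<close>. On values \<open>c\<close> of probability zero it is \<open>M\<close>, so that it is a
probability measure for every \<open>c\<close>.\<close>

definition cond_measure :: "'w measure \<Rightarrow> ('w \<Rightarrow> 'c) \<Rightarrow> 'c \<Rightarrow> 'w measure" where
  "cond_measure M Z c = (if c \<in> set_pmf (law M Z) then uniform_measure M {w\<in>space M. Z w = c} else M)"

context prob_space
begin

lemma emeasure_law_fibre:
  assumes Z: "simple_function M Z"
  shows "{w\<in>space M. Z w = c} \<in> sets M" "emeasure M {w\<in>space M. Z w = c} = ennreal (pmf (law M Z) c)"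
proof -
  show "{w\<in>space M. Z w = c} \<in> sets M"
    using simple_functionD(2)[OF Z, of "{c}"] by (simp add: vimage_def Int_def conj_commute)
  have "pmf (law M Z) c = measure M {w\<in>space M. Z w = c}"
    using measure_law[OF Z, of "{c}"] by (simp add: pmf.rep_eq)
  then show "emeasure M {w\<in>space M. Z w = c} = ennreal (pmf (law M Z) c)"
    by (simp add: emeasure_eq_measure)
qed

lemma cond_measure_prob_algebra:
  assumes Z: "simple_function M Z" and N: "sets M = sets N"
  shows "cond_measure M Z c \<in> space (prob_algebra N)"
proof -
  have "prob_space (uniform_measure M {w\<in>space M. Z w = c})" if "c \<in> set_pmf (law M Z)"
    using that by (intro prob_space_uniform_measure) (auto simp: emeasure_law_fibre[OF Z] set_pmf_iff)
  then show ?thesis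
    using N prob_space_axioms by (auto simp: space_prob_algebra cond_measure_def)
qed

lemma AE_cond_measure:
  assumes Z: "simple_function M Z" and c: "c \<in> set_pmf (law M Z)"
  shows "AE w in cond_measure M Z c. Z w = c"
  using c unfolding cond_measure_def
  by (auto intro!: AE_uniform_measureI emeasure_law_fibre[OF Z])

text \<open>The law of total probability.\<close>

lemma bind_cond_measure:
  assumes Z: "simple_function M Z"
  shows "measure_pmf (law M Z) \<bind> cond_measure M Z = M"
proof (rule measure_eqI)
  have pa: "cond_measure M Z c \<in> space (prob_algebra M)" for c
    by (rule cond_measure_prob_algebra[OF Z refl])
  show sets: "sets (measure_pmf (law M Z) \<bind> cond_measure M Z) = sets M"
    by (rule prob_algebraD(2)[OF bind_kernel_prob_algebra]) (rule pa)
  fix A assume "A \<in> sets (measure_pmf (law M Z) \<bind> cond_measure M Z)"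
  then have A: "A \<in> sets M"
    by (simp add: sets)
  let ?F = "\<lambda>c. {w\<in>space M. Z w = c}"
  have F: "?F c \<in> sets M" for c
    by (rule emeasure_law_fibre[OF Z])
  have fin: "finite (Z ` space M)"
    using Z by (rule simple_functionD)
  have "emeasure (measure_pmf (law M Z) \<bind> cond_measure M Z) A
      = (\<integral>\<^sup>+c. emeasure (cond_measure M Z c) A \<partial>law M Z)"
    by (rule emeasure_bind_kernel[OF pa A])
  also have "\<dots> = (\<Sum>c\<in>Z ` space M. emeasure (cond_measure M Z c) A * ennreal (pmf (law M Z) c))"
    by (rule nn_integral_measure_pmf_support[OF fin]) (use set_law_subset[OF Z] in auto)
  also have "\<dots> = (\<Sum>c\<in>Z ` space M. emeasure M (?F c \<inter> A))"
  proof (rule sum.cong[OF refl])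
    fix c
    show "emeasure (cond_measure M Z c) A * ennreal (pmf (law M Z) c) = emeasure M (?F c \<inter> A)"
    proof (cases "c \<in> set_pmf (law M Z)")
      case True
      then have "emeasure M (?F c) \<noteq> 0" "emeasure M (?F c) \<noteq> \<infinity>"
        by (auto simp: emeasure_law_fibre[OF Z] set_pmf_iff)
      moreover have "emeasure (cond_measure M Z c) A = emeasure M (?F c \<inter> A) / emeasure M (?F c)"
        using True F A by (simp add: cond_measure_def)
      ultimately show ?thesis
        unfolding emeasure_law_fibre(2)[OF Z, symmetric]
        by (simp add: ennreal_divide_times ennreal_divide_self less_top[symmetric])
    next
      case False
      then have "emeasure M (?F c) = 0"
        by (simp add: emeasure_law_fibre[OF Z] set_pmf_iff)
      then have "emeasure M (?F c \<inter> A) = 0"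
        by (rule emeasure_eq_0[OF F]) auto
      then show ?thesis
        using False by (simp add: set_pmf_iff)
    qed
  qed
  also have "\<dots> = emeasure M (\<Union>c\<in>Z ` space M. ?F c \<inter> A)"
    by (rule sum_emeasure) (use F A fin in \<open>auto simp: disjoint_family_on_def\<close>)
  also have "(\<Union>c\<in>Z ` space M. ?F c \<inter> A) = A"
    using sets.sets_into_space[OF A] by auto
  finally show "emeasure (measure_pmf (law M Z) \<bind> cond_measure M Z) A = emeasure M A" .
qed

end

section \<open>Mutual information and transport distance of finite mixtures\<close>

lemma mixture_joint_pmf:
  fixes \<nu> :: "'l pmf" and k :: "'l \<Rightarrow> 'c pmf" and N :: "'k measure"
  assumes m: "\<And>c. m c \<in> space (prob_algebra N)"
  defines "L \<equiv> count_space (UNIV :: 'l set)"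
  defines "M \<equiv> mixture_joint L N (measure_pmf \<nu>) (\<lambda>y. measure_pmf (k y) \<bind> m)"
  shows "M \<in> space (prob_algebra (L \<Otimes>\<^sub>M N))"
    and "A \<in> sets (L \<Otimes>\<^sub>M N) \<Longrightarrow> emeasure M A
      = (\<integral>\<^sup>+(y, c). emeasure (m c) {x\<in>space N. (y, x) \<in> A} \<partial>joint_pmf \<nu> k)"
proof -
  define D where "D y = distr (measure_pmf (k y) \<bind> m) (L \<Otimes>\<^sub>M N) (Pair y)" for y
  have km: "measure_pmf (k y) \<bind> m \<in> space (prob_algebra N)" for y
    by (rule bind_kernel_prob_algebra[OF m])
  note km' = prob_algebraD[OF km]
  have Pair: "Pair y \<in> N \<rightarrow>\<^sub>M L \<Otimes>\<^sub>M N" for y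
    by (rule measurable_Pair1') (simp add: L_def)
  have Pair': "Pair y \<in> (measure_pmf (k y) \<bind> m) \<rightarrow>\<^sub>M L \<Otimes>\<^sub>M N" for y
    using Pair by (simp add: measurable_cong_sets[OF km'(2) refl])
  have D: "D y \<in> space (prob_algebra (L \<Otimes>\<^sub>M N))" for y
    using prob_space.prob_space_distr[OF km'(1) Pair'] by (simp add: D_def space_prob_algebra)
  have "(measure_pmf (k y) \<bind> m) \<bind> (\<lambda>x. return (L \<Otimes>\<^sub>M N) (y, x)) = D y" for y
    unfolding D_def
    by (rule bind_return_distr'[OF _ Pair']) (use prob_space.not_empty[OF km'(1)] in auto)
  then have M: "M = measure_pmf \<nu> \<bind> D"
    unfolding M_def mixture_joint_def by simp
  show "M \<in> space (prob_algebra (L \<Otimes>\<^sub>M N))"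
    unfolding M by (rule bind_kernel_prob_algebra[OF D])
  assume A: "A \<in> sets (L \<Otimes>\<^sub>M N)"
  have sec: "{x\<in>space N. (y, x) \<in> A} \<in> sets N" for y
    using measurable_sets[OF Pair A, of y] by (simp add: vimage_def Int_def conj_commute)
  have "emeasure M A = (\<integral>\<^sup>+y. emeasure (D y) A \<partial>\<nu>)"
    unfolding M by (rule emeasure_bind_kernel[OF D A])
  also have "\<dots> = (\<integral>\<^sup>+y. \<integral>\<^sup>+c. emeasure (m c) {x\<in>space N. (y, x) \<in> A} \<partial>k y \<partial>\<nu>)"
  proof (rule nn_integral_cong)
    fix y
    have "emeasure (D y) A = emeasure (measure_pmf (k y) \<bind> m) {x\<in>space N. (y, x) \<in> A}"
      unfolding D_def using sets.sets_into_space[OF A] km'(3)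
      by (subst emeasure_distr[OF Pair' A])
         (auto simp: space_pair_measure intro!: arg_cong[where f = "emeasure _"])
    then show "emeasure (D y) A = (\<integral>\<^sup>+c. emeasure (m c) {x\<in>space N. (y, x) \<in> A} \<partial>k y)"
      using emeasure_bind_kernel[OF m sec] by simp
  qed
  also have "\<dots> = (\<integral>\<^sup>+(y, c). emeasure (m c) {x\<in>space N. (y, x) \<in> A} \<partial>joint_pmf \<nu> k)"
    by (simp add: joint_pmf_def)
  finally show "emeasure M A
      = (\<integral>\<^sup>+(y, c). emeasure (m c) {x\<in>space N. (y, x) \<in> A} \<partial>joint_pmf \<nu> k)" .
qed

text \<open>The joint law of the index and of a quantization of the point arises from the joint law of
index \<open>y\<close> and label \<open>c\<close> by processing the label through the kernel \<open>m\<close>, so each quantized mutual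
information is at most that of index and label.\<close>

lemma mixture_info_le_pmf_MI:
  fixes \<nu> :: "'l pmf" and k :: "'l \<Rightarrow> 'c pmf" and N :: "'k measure"
  assumes m: "\<And>c. m c \<in> space (prob_algebra N)"
    and fin: "finite (set_pmf (joint_pmf \<nu> k))"
  shows "mixture_info (count_space UNIV) N (measure_pmf \<nu>) (\<lambda>y. measure_pmf (k y) \<bind> m)
    \<le> ereal (pmf_MI (joint_pmf \<nu> k))"
proof -
  let ?L = "count_space (UNIV :: 'l set)"
  define M where "M = mixture_joint ?L N (measure_pmf \<nu>) (\<lambda>y. measure_pmf (k y) \<bind> m)"
  note M = mixture_joint_pmf[where m = m and N = N and \<nu> = \<nu> and k = k, OF m, folded M_def]
  interpret M: prob_space M
    using M(1) by (rule prob_algebraD)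
  have sM: "sets M = sets (?L \<Otimes>\<^sub>M N)" "space M = UNIV \<times> space N"
    using prob_algebraD[OF M(1)] by (simp_all add: space_pair_measure)
  have fs: "fst \<in> M \<rightarrow>\<^sub>M ?L" "snd \<in> M \<rightarrow>\<^sub>M N"
    by (simp_all only: measurable_cong_sets[OF sM(1) refl] measurable_fst measurable_snd)
  have "finite_mutual_info M (\<lambda>w. quantize P (fst w)) (\<lambda>w. quantize Q (snd w)) \<le> pmf_MI (joint_pmf \<nu> k)"
    if P: "P \<in> finite_partitions ?L" and Q: "Q \<in> finite_partitions N" for P Q
  proof -
    define W where "W w = (quantize P (fst w), quantize Q (snd w))" for w :: "'l \<times> 'k"
    have W: "simple_function M W"
      unfolding W_def
      by (intro simple_function_Pair simple_function_quantize[OF P fs(1)] simple_function_quantize[OF Q fs(2)])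
    have qQ: "simple_function (m c) (quantize Q)" for c
      using simple_function_quantize[OF Q, of "\<lambda>x. x" "m c"] prob_algebraD(2)[OF m]
      by (simp add: measurable_ident_sets)
    have "law M W = bind_pmf (joint_pmf \<nu> k) (\<lambda>(y, c). pair_pmf (return_pmf (quantize P y)) (law (m c) (quantize Q)))"
    proof (rule pmf_eqI)
      fix z :: "'l set \<times> 'k set"
      obtain u v where z: "z = (u, v)" by (cases z)
      let ?A = "{w\<in>space M. W w = z}"
      have A: "?A \<in> sets M"
        by (rule M.emeasure_law_fibre[OF W])
      have "ennreal (pmf (law M W) z) = emeasure M ?A"
        by (rule M.emeasure_law_fibre(2)[OF W, symmetric])
      also have "\<dots> = (\<integral>\<^sup>+(y, c). emeasure (m c) {x\<in>space N. (y, x) \<in> ?A} \<partial>joint_pmf \<nu> k)"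
        by (rule M(2)) (use A sM in simp)
      also have "\<dots> = (\<integral>\<^sup>+(y, c). ennreal (pmf (pair_pmf (return_pmf (quantize P y)) (law (m c) (quantize Q))) z) \<partial>joint_pmf \<nu> k)"
      proof (rule nn_integral_cong, unfold split_paired_all prod.case)
        fix y c
        interpret mc: prob_space "m c"
          using m by (rule prob_algebraD)
        have "{x \<in> space N. (y, x) \<in> ?A}
            = (if quantize P y = u then {x\<in>space (m c). quantize Q x = v} else {})"
          using prob_algebraD(3)[OF m] by (auto simp: W_def sM z)
        then show "emeasure (m c) {x \<in> space N. (y, x) \<in> ?A}
            = ennreal (pmf (pair_pmf (return_pmf (quantize P y)) (law (m c) (quantize Q))) z)"
          by (simp add: mc.emeasure_law_fibre[OF qQ] z pmf_pair)
      qed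
      also have "\<dots> = ennreal (pmf (bind_pmf (joint_pmf \<nu> k)
          (\<lambda>(y, c). pair_pmf (return_pmf (quantize P y)) (law (m c) (quantize Q)))) z)"
        unfolding ennreal_pmf_bind by (rule nn_integral_cong) (simp add: split_beta)
      finally show "pmf (law M W) z = pmf (bind_pmf (joint_pmf \<nu> k)
          (\<lambda>(y, c). pair_pmf (return_pmf (quantize P y)) (law (m c) (quantize Q)))) z"
        by simp
    qed
    moreover have "finite_mutual_info M (\<lambda>w. quantize P (fst w)) (\<lambda>w. quantize Q (snd w)) = pmf_MI (law M W)"
      using M.finite_mutual_info_eq_pmf_MI[OF W[unfolded W_def]] by (simp add: W_def[abs_def])
    moreover have "pmf_MI (bind_pmf (joint_pmf \<nu> k)
        (\<lambda>(y, c). pair_pmf (return_pmf (quantize P y)) (law (m c) (quantize Q)))) \<le> pmf_MI (joint_pmf \<nu> k)"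
      by (rule pmf_MI_bind_le[OF fin])
         (use prob_space.finite_set_law[OF prob_algebraD(1)[OF m] qQ] in auto)
    ultimately show ?thesis
      by simp
  qed
  then show ?thesis
    unfolding mixture_info_def mutual_info_def M_def[symmetric] by (auto intro!: SUP_least)
qed

text \<open>A coupling \<open>\<Lambda>\<close> of the labels lifts to a coupling of the mixtures: draw \<open>(c, d)\<close> from \<open>\<Lambda>\<close>,
then \<open>x\<close> from \<open>m c\<close>, and pair it with the point \<open>r d\<close>. The cost enters through a measurable
majorant \<open>g\<close>.\<close>

lemma transport_dist_mixture_le:
  fixes \<Lambda> :: "('c \<times> 'd) pmf" and g :: "(nat \<Rightarrow> 'a) \<times> (nat \<Rightarrow> 'a) \<Rightarrow> ennreal"
  assumes m: "\<And>c. m c \<in> space (prob_algebra N)"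
    and r: "\<And>d. r d \<in> space N"
    and g: "g \<in> borel_measurable (N \<Otimes>\<^sub>M N)"
    and le: "\<And>x z. x \<in> space N \<Longrightarrow> z \<in> space N \<Longrightarrow> ennreal (avg_dist n K x z) \<le> g (x, z)"
  shows "transport_dist n K (measure_pmf (map_pmf fst \<Lambda>) \<bind> m) (distr (measure_pmf (map_pmf snd \<Lambda>)) N r)
    \<le> (\<integral>\<^sup>+(c, d). \<integral>\<^sup>+x. g (x, r d) \<partial>m c \<partial>\<Lambda>)"
proof -
  define h where "h = (\<lambda>(c, d). distr (m c) (N \<Otimes>\<^sub>M N) (\<lambda>x. (x, r d)))"
  define \<pi> where "\<pi> = measure_pmf \<Lambda> \<bind> h"
  define \<mu> where "\<mu> = measure_pmf (map_pmf fst \<Lambda>) \<bind> m"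
  define \<xi> where "\<xi> = distr (measure_pmf (map_pmf snd \<Lambda>)) N r"
  note mD = prob_algebraD[OF m]
  have pr: "(\<lambda>x. (x, r d)) \<in> m c \<rightarrow>\<^sub>M N \<Otimes>\<^sub>M N" for c d
    by (intro measurable_Pair measurable_ident_sets[OF mD(2)] measurable_const r)
  have h: "h w \<in> space (prob_algebra (N \<Otimes>\<^sub>M N))" for w
    using prob_space.prob_space_distr[OF mD(1) pr]
    by (cases w) (simp add: h_def space_prob_algebra)
  have \<pi>: "\<pi> \<in> space (prob_algebra (N \<Otimes>\<^sub>M N))"
    unfolding \<pi>_def by (rule bind_kernel_prob_algebra[OF h])
  note \<pi>D = prob_algebraD[OF \<pi>]
  have \<mu>: "\<mu> \<in> space (prob_algebra N)"
    unfolding \<mu>_def by (rule bind_kernel_prob_algebra[OF m])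
  have sets: "sets \<mu> = sets N" "sets \<xi> = sets N"
    using prob_algebraD[OF \<mu>] by (simp_all add: \<xi>_def)
  have prod: "sets (\<mu> \<Otimes>\<^sub>M \<xi>) = sets (N \<Otimes>\<^sub>M N)"
    by (rule sets_pair_measure_cong[OF sets])
  have "\<pi> \<in> couplings \<mu> \<xi>"
    unfolding couplings_def
  proof (intro CollectI conjI)
    show "\<pi> \<in> space (prob_algebra (\<mu> \<Otimes>\<^sub>M \<xi>))"
      using \<pi> prod by (simp add: space_prob_algebra)
    have fst: "fst \<in> \<pi> \<rightarrow>\<^sub>M \<mu>" and snd: "snd \<in> \<pi> \<rightarrow>\<^sub>M \<xi>"
      by (simp_all only: measurable_cong_sets[OF \<pi>D(2) sets(1)] measurable_cong_sets[OF \<pi>D(2) sets(2)]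
          measurable_fst measurable_snd)
    show "distr \<pi> \<mu> fst = \<mu>"
    proof (rule measure_eqI)
      fix A assume "A \<in> sets (distr \<pi> \<mu> fst)"
      then have A: "A \<in> sets N" by (simp add: sets)
      then have A': "A \<times> space N \<in> sets (N \<Otimes>\<^sub>M N)" by simp
      have "emeasure (distr \<pi> \<mu> fst) A = emeasure \<pi> (A \<times> space N)"
        using A sets.sets_into_space[OF A]
        by (subst emeasure_distr[OF fst])
           (auto simp: sets \<pi>D(3) space_pair_measure intro!: arg_cong[where f = "emeasure _"])
      also have "\<dots> = (\<integral>\<^sup>+w. emeasure (h w) (A \<times> space N) \<partial>\<Lambda>)"
        unfolding \<pi>_def by (rule emeasure_bind_kernel[OF h A'])
      also have "\<dots> = (\<integral>\<^sup>+w. emeasure (m (fst w)) A \<partial>\<Lambda>)"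
      proof (rule nn_integral_cong, clarify)
        fix c d
        show "emeasure (h (c, d)) (A \<times> space N) = emeasure (m (fst (c, d))) A"
          unfolding h_def prod.case using r sets.sets_into_space[OF A]
          by (subst emeasure_distr[OF pr A']) (auto simp: mD(3) intro!: arg_cong[where f = "emeasure _"])
      qed
      also have "\<dots> = emeasure \<mu> A"
        unfolding \<mu>_def by (subst emeasure_bind_kernel[OF m A]) simp
      finally show "emeasure (distr \<pi> \<mu> fst) A = emeasure \<mu> A" .
    qed simp
    show "distr \<pi> \<xi> snd = \<xi>"
    proof (rule measure_eqI)
      fix A assume "A \<in> sets (distr \<pi> \<xi> snd)"
      then have A: "A \<in> sets N" by (simp add: sets)
      then have A': "space N \<times> A \<in> sets (N \<Otimes>\<^sub>M N)" by simp
      have "emeasure (distr \<pi> \<xi> snd) A = emeasure \<pi> (space N \<times> A)"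
        using A sets.sets_into_space[OF A]
        by (subst emeasure_distr[OF snd])
           (auto simp: sets \<pi>D(3) space_pair_measure intro!: arg_cong[where f = "emeasure _"])
      also have "\<dots> = (\<integral>\<^sup>+w. emeasure (h w) (space N \<times> A) \<partial>\<Lambda>)"
        unfolding \<pi>_def by (rule emeasure_bind_kernel[OF h A'])
      also have "\<dots> = (\<integral>\<^sup>+w. indicator (r -` A) (snd w) \<partial>\<Lambda>)"
      proof (rule nn_integral_cong, clarify)
        fix c d
        have "(\<lambda>x. (x, r d)) -` (space N \<times> A) \<inter> space (m c) = (if r d \<in> A then space (m c) else {})"
          by (auto simp: mD(3))
        then show "emeasure (h (c, d)) (space N \<times> A) = indicator (r -` A) (snd (c, d))"
          unfolding h_def prod.case
          by (subst emeasure_distr[OF pr A']) (auto simp: prob_space.emeasure_space_1[OF mD(1)])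
      qed
      also have "\<dots> = (\<integral>\<^sup>+d. indicator (r -` A) d \<partial>map_pmf snd \<Lambda>)"
        by (simp only: nn_integral_map_pmf)
      also have "\<dots> = emeasure (measure_pmf (map_pmf snd \<Lambda>)) (r -` A)"
        by (rule nn_integral_indicator) simp
      also have "\<dots> = emeasure \<xi> A"
        unfolding \<xi>_def using r A by (subst emeasure_distr) (auto simp del: emeasure_map_pmf)
      finally show "emeasure (distr \<pi> \<xi> snd) A = emeasure \<xi> A" .
    qed simp
  qed
  then have "transport_dist n K \<mu> \<xi> \<le> (\<integral>\<^sup>+(x, z). ennreal (avg_dist n K x z) \<partial>\<pi>)"
    unfolding transport_dist_def by (rule INF_lower)
  also have "\<dots> \<le> (\<integral>\<^sup>+w. g w \<partial>\<pi>)"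
    by (rule nn_integral_mono) (auto simp: \<pi>D(3) space_pair_measure intro!: le)
  also have "\<dots> = (\<integral>\<^sup>+w. \<integral>\<^sup>+v. g v \<partial>h w \<partial>\<Lambda>)"
    unfolding \<pi>_def by (rule nn_integral_bind[OF g measurable_kernel_pmf[OF h]])
  also have "\<dots> = (\<integral>\<^sup>+(c, d). \<integral>\<^sup>+x. g (x, r d) \<partial>m c \<partial>\<Lambda>)"
    by (rule nn_integral_cong) (auto simp: h_def nn_integral_distr[OF pr] g)
  finally show ?thesis
    unfolding \<mu>_def \<xi>_def .
qed

lemma is_product_measure_Pi_pmf:
  assumes sep: "\<And>i. i \<in> {1..n} \<Longrightarrow> separable_space (mtopology_of (K i))"
    and r: "\<And>i d. i \<in> {1..n} \<Longrightarrow> r i d \<in> mspace (K i)"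
  shows "is_product_measure n K (distr (measure_pmf (Pi_pmf {1..n} undefined q)) (product_borel n K)
      (\<lambda>d. \<lambda>i\<in>{1..n}. r i (d i)))"
proof -
  define B where "B i = borel_of (mtopology_of (K i))" for i
  \<comment> \<open>Outside \<open>{1..n}\<close> an arbitrary probability measure completes the family.\<close>
  define \<eta> where "\<eta> i = (if i \<in> {1..n} then distr (measure_pmf (q i)) (B i) (r i)
      else return (count_space UNIV) undefined)" for i
  have \<eta>: "prob_space (\<eta> i)" for i
    unfolding \<eta>_def using r
    by (auto intro!: measure_pmf.prob_space_distr prob_space_return simp: B_def)
  have sets\<eta>: "sets (\<eta> i) = sets (B i)" if "i \<in> {1..n}" for i
    using that by (simp add: \<eta>_def)
  interpret product_prob_space \<eta> "{1..n}"
    by (rule product_prob_spaceI) (rule \<eta>)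
  let ?N = "product_borel n K" and ?r = "\<lambda>d. \<lambda>i\<in>{1..n}. r i (d i)"
  have setsN: "sets ?N = sets (PiM {1..n} \<eta>)"
  proof -
    have "sets ?N = sets (PiM {1..n} (\<lambda>i. borel_of (mtopology_of (K i))))"
      by (rule sets_product_borel) (rule sep)
    also have "\<dots> = sets (PiM {1..n} \<eta>)"
      by (rule sets_PiM_cong) (auto simp: sets\<eta> B_def)
    finally show ?thesis .
  qed
  have rN: "?r d \<in> space ?N" for d
    unfolding product_borel_def using r by simp
  have "distr (measure_pmf (Pi_pmf {1..n} undefined q)) ?N ?r = PiM {1..n} \<eta>"
  proof (rule PiM_eqI)
    fix A assume A: "\<And>i. i \<in> {1..n} \<Longrightarrow> A i \<in> sets (\<eta> i)"
    have "Pi\<^sub>E {1..n} A \<in> sets ?N"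
      unfolding setsN using A by (intro sets_PiM_I_finite) auto
    then have "emeasure (distr (measure_pmf (Pi_pmf {1..n} undefined q)) ?N ?r) (Pi\<^sub>E {1..n} A)
        = emeasure (Pi_pmf {1..n} undefined q) (Pi {1..n} (\<lambda>i. r i -` A i))"
      using rN by (subst emeasure_distr) (auto simp: Pi_iff intro!: arg_cong[where f = "emeasure _"])
    also have "\<dots> = ennreal (\<Prod>i\<in>{1..n}. measure (q i) (r i -` A i))"
      by (simp add: measure_pmf.emeasure_eq_measure measure_Pi_pmf_Pi)
    also have "\<dots> = (\<Prod>i\<in>{1..n}. emeasure (q i) (r i -` A i))"
      by (simp add: measure_pmf.emeasure_eq_measure prod_ennreal)
    also have "\<dots> = (\<Prod>i\<in>{1..n}. emeasure (\<eta> i) (A i))"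
    proof (rule prod.cong[OF refl])
      fix i assume i: "i \<in> {1..n}"
      then show "emeasure (q i) (r i -` A i) = emeasure (\<eta> i) (A i)"
        using A[OF i] sets\<eta>[OF i] r by (simp add: \<eta>_def emeasure_distr B_def)
    qed
    finally show "emeasure (distr (measure_pmf (Pi_pmf {1..n} undefined q)) ?N ?r) (Pi\<^sub>E {1..n} A)
      = (\<Prod>i\<in>{1..n}. emeasure (\<eta> i) (A i))" .
  qed (use setsN in auto)
  moreover have "\<eta> i \<in> space (prob_algebra (borel_of (mtopology_of (K i))))" if "i \<in> {1..n}" for i
    using \<eta>[of i] sets\<eta>[OF that] by (simp add: space_prob_algebra B_def)
  ultimately show ?thesis
    unfolding is_product_measure_def by blast
qed

section \<open>The quantized measure\<close>

text \<open>A measure on the product space together with partitions \<open>P i\<close> of the factors, whose cells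
in \<open>G i\<close> have diameter at most \<open>\<epsilon>\<close> and together miss at most \<open>\<epsilon>\<close> of the mass.\<close>

locale small_cells =
  fixes n :: nat and K :: "nat \<Rightarrow> 'a metric" and \<mu> :: "(nat \<Rightarrow> 'a) measure"
    and P G :: "nat \<Rightarrow> 'a set set" and \<epsilon> :: real
  assumes n: "n \<ge> 1"
    and sep: "\<And>i. i \<in> {1..n} \<Longrightarrow> separable_space (mtopology_of (K i))"
    and diam: "\<And>i x y. i \<in> {1..n} \<Longrightarrow> x \<in> mspace (K i) \<Longrightarrow> y \<in> mspace (K i) \<Longrightarrow> mdist (K i) x y \<le> 1"
    and \<mu>: "\<mu> \<in> space (prob_algebra (product_borel n K))"
    and \<epsilon>: "\<epsilon> > 0"
    and P: "\<And>i. i \<in> {1..n} \<Longrightarrow> P i \<in> finite_partitions (borel_of (mtopology_of (K i)))"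
    and G: "\<And>i. i \<in> {1..n} \<Longrightarrow> G i \<subseteq> P i"
    and small: "\<And>i C x y. i \<in> {1..n} \<Longrightarrow> C \<in> G i \<Longrightarrow> x \<in> C \<Longrightarrow> y \<in> C \<Longrightarrow> mdist (K i) x y \<le> \<epsilon>"
    and rare: "\<And>i. i \<in> {1..n} \<Longrightarrow> measure \<mu> {x\<in>space \<mu>. x i \<notin> \<Union>(G i)} \<le> \<epsilon>"
begin

abbreviation I where "I \<equiv> {1..n}"
abbreviation N where "N \<equiv> product_borel n K"

definition cells :: "(nat \<Rightarrow> 'a) \<Rightarrow> nat \<Rightarrow> 'a set" where
  "cells x = (\<lambda>i\<in>I. quantize (P i) (x i))"

definition cell_law :: "(nat \<Rightarrow> 'a set) pmf" where
  "cell_law = law \<mu> cells"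

sublocale prob_space \<mu>
  using \<mu> by (rule prob_algebraD)

lemma sets_\<mu>: "sets \<mu> = sets N" and space_\<mu>: "space \<mu> = space N"
  using \<mu> by (rule prob_algebraD)+

lemma space_N: "space N = (\<Pi>\<^sub>E i\<in>I. mspace (K i))"
  by (simp add: product_borel_def)

lemma coordinate_measurable:
  assumes "i \<in> I"
  shows "(\<lambda>x. x i) \<in> N \<rightarrow>\<^sub>M borel_of (mtopology_of (K i))"
proof -
  have "sets N = sets (PiM I (\<lambda>i. borel_of (mtopology_of (K i))))"
    by (rule sets_product_borel) (rule sep)
  from measurable_cong_sets[OF this refl] show ?thesis
    using measurable_component_singleton[OF assms] by blast
qed

lemma simple_coordinate: "i \<in> I \<Longrightarrow> simple_function \<mu> (\<lambda>x. quantize (P i) (x i))"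
  by (rule simple_function_quantize[OF P])
     (simp_all only: measurable_cong_sets[OF sets_\<mu> refl] coordinate_measurable)

lemma simple_cells: "simple_function \<mu> cells"
  unfolding cells_def by (rule simple_function_PiE) (auto intro: simple_coordinate)

lemma finite_cell_law: "finite (set_pmf cell_law)"
  unfolding cell_law_def by (rule finite_set_law[OF simple_cells])

lemma set_cell_law: "set_pmf cell_law \<subseteq> cells ` space N"
  unfolding cell_law_def space_\<mu>[symmetric] by (rule set_law_subset[OF simple_cells])

lemma partition_cells: "i \<in> I \<Longrightarrow> partition_on (mspace (K i)) (P i)"
  using P[of i] by (simp add: finite_partitions_def)

lemma pmf_DTC_le: "ereal (pmf_DTC I cell_law) \<le> DTC_measure I (\<lambda>i. borel_of (mtopology_of (K i))) \<mu>"
proof -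
  have "pmf_DTC I cell_law = finite_DTC \<mu> I (\<lambda>i x. quantize (P i) (x i))"
    unfolding cell_law_def cells_def[abs_def] by (rule finite_DTC_eq_pmf_DTC[symmetric]) (auto intro: simple_coordinate)
  then show ?thesis
    unfolding DTC_measure_def DTC_def by (simp only:) (rule SUP_upper, use P in auto)
qed

lemma measure_bad_cells_le:
  assumes i: "i \<in> I"
  shows "measure cell_law {c. c i \<notin> G i} \<le> \<epsilon>"
proof -
  have "measure cell_law {c. c i \<notin> G i} = measure \<mu> {x\<in>space \<mu>. x i \<notin> \<Union>(G i)}"
    unfolding cell_law_def measure_law[OF simple_cells]
  proof (intro arg_cong[where f = "measure \<mu>"] Collect_cong conj_cong refl)
    fix x assume "x \<in> space \<mu>"
    then have x: "x i \<in> mspace (K i)"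
      using i by (auto simp: space_\<mu> space_N)
    have "quantize (P i) (x i) \<in> G i \<longleftrightarrow> x i \<in> \<Union>(G i)"
      using quantize_mem[OF partition_cells[OF i] x] quantize_eqI[OF partition_cells[OF i]] G[OF i] by blast
    then show "cells x \<in> {c. c i \<notin> G i} \<longleftrightarrow> x i \<notin> \<Union>(G i)"
      using i by (simp add: cells_def)
  qed
  then show ?thesis
    using rare[OF i] by simp
qed

text \<open>A representative point of the cell \<open>C\<close>. The product measures that approximate the mixture
are laws of representatives of independent cells; the second branch keeps them in the space for
arguments that are not cells.\<close>

definition rep :: "nat \<Rightarrow> 'a set \<Rightarrow> 'a" where
  "rep i C = (if C \<inter> mspace (K i) \<noteq> {} then SOME x. x \<in> C \<inter> mspace (K i) else SOME x. x \<in> mspace (K i))"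

definition reps :: "(nat \<Rightarrow> 'a set) \<Rightarrow> nat \<Rightarrow> 'a" where
  "reps d = (\<lambda>i\<in>I. rep i (d i))"

lemma rep_mspace: "i \<in> I \<Longrightarrow> rep i C \<in> mspace (K i)"
proof -
  assume i: "i \<in> I"
  obtain x where "x \<in> space N"
    using not_empty space_\<mu> by auto
  then have "x i \<in> mspace (K i)"
    using i by (auto simp: space_N)
  then have "(SOME x. x \<in> mspace (K i)) \<in> mspace (K i)"
    by (rule someI)
  moreover have "(SOME x. x \<in> C \<inter> mspace (K i)) \<in> C \<inter> mspace (K i)" if "C \<inter> mspace (K i) \<noteq> {}"
    using that by (intro some_in_eq[THEN iffD2])
  ultimately show "rep i C \<in> mspace (K i)"
    by (auto simp: rep_def)
qed

lemma rep_mem: "x \<in> C \<Longrightarrow> x \<in> mspace (K i) \<Longrightarrow> rep i C \<in> C"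
  using some_in_eq[of "C \<inter> mspace (K i)"] by (auto simp: rep_def)

lemma reps_space: "reps d \<in> space N"
  by (auto simp: space_N reps_def rep_mspace)

text \<open>Pairs whose coordinates at \<open>i\<close> share a small cell. There the distance at \<open>i\<close> is at most
\<open>\<epsilon>\<close>; elsewhere it is bounded by the diameter.\<close>

definition near :: "nat \<Rightarrow> ((nat \<Rightarrow> 'a) \<times> (nat \<Rightarrow> 'a)) set" where
  "near i = {v\<in>space (N \<Otimes>\<^sub>M N). \<exists>C\<in>G i. fst v i \<in> C \<and> snd v i \<in> C}"

lemma near_sets: "i \<in> I \<Longrightarrow> near i \<in> sets (N \<Otimes>\<^sub>M N)"
proof -
  assume i: "i \<in> I"
  have f: "(\<lambda>v. fst v i) \<in> N \<Otimes>\<^sub>M N \<rightarrow>\<^sub>M borel_of (mtopology_of (K i))"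
    "(\<lambda>v. snd v i) \<in> N \<Otimes>\<^sub>M N \<rightarrow>\<^sub>M borel_of (mtopology_of (K i))"
    by (rule measurable_compose[OF _ coordinate_measurable[OF i]], simp)+
  have C: "C \<in> sets (borel_of (mtopology_of (K i)))" if "C \<in> G i" for C
    using P[OF i] G[OF i] that by (auto simp: finite_partitions_def)
  have fin: "finite (G i)"
    using P[OF i] G[OF i] by (auto simp: finite_partitions_def intro: finite_subset)
  have "near i = (\<Union>C\<in>G i. ((\<lambda>v. fst v i) -` C \<inter> space (N \<Otimes>\<^sub>M N)) \<inter> ((\<lambda>v. snd v i) -` C \<inter> space (N \<Otimes>\<^sub>M N)))"
    by (auto simp: near_def)
  also have "\<dots> \<in> sets (N \<Otimes>\<^sub>M N)"
    using C fin by (intro sets.finite_UN sets.Int measurable_sets[OF f(1)] measurable_sets[OF f(2)])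
  finally show "near i \<in> sets (N \<Otimes>\<^sub>M N)" .
qed

definition cost_bound :: "(nat \<Rightarrow> 'a) \<times> (nat \<Rightarrow> 'a) \<Rightarrow> real" where
  "cost_bound v = (\<Sum>i\<in>I. \<epsilon> + (1 - indicator (near i) v)) / n"

lemma avg_dist_le_cost_bound:
  assumes "x \<in> space N" "z \<in> space N"
  shows "avg_dist n K x z \<le> cost_bound (x, z)"
proof -
  have "mdist (K i) (x i) (z i) \<le> \<epsilon> + (1 - indicator (near i) (x, z))" if i: "i \<in> I" for i
  proof (cases "(x, z) \<in> near i")
    case True
    then show ?thesis
      using small[OF i] by (auto simp: near_def)
  next
    case False
    then show ?thesis
      using diam[OF i, of "x i" "z i"] assms i \<epsilon> by (auto simp: space_N PiE_iff)
  qed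
  then show ?thesis
    unfolding avg_dist_def cost_bound_def by (auto intro!: divide_right_mono sum_mono)
qed

lemma cost_bound_measurable: "(\<lambda>v. ennreal (cost_bound v)) \<in> borel_measurable (N \<Otimes>\<^sub>M N)"
  unfolding cost_bound_def using near_sets by measurable

end

section \<open>The mixture that resamples a set of coordinates\<close>

context small_cells
begin

lemma restrict_cell_law: "c \<in> set_pmf cell_law \<Longrightarrow> restrict c I = c"
  using set_cell_law by (auto simp: cells_def)

context
  fixes S :: "nat set"
  assumes S: "S \<subseteq> I"
begin

text \<open>The index of the mixture: the cells of the coordinates in \<open>S\<close>.\<close>

definition seen :: "(nat \<Rightarrow> 'a set) \<Rightarrow> nat \<Rightarrow> 'a set" where
  "seen c = restrict c S"

definition unseen :: "(nat \<Rightarrow> 'a set) \<Rightarrow> nat \<Rightarrow> 'a set" where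
  "unseen c = restrict c (I - S)"

definition given :: "(nat \<Rightarrow> 'a set) \<Rightarrow> (nat \<Rightarrow> 'a set) pmf" where
  "given z = fibre_pmf cell_law seen z"

text \<open>\<open>\<mu>\<close> conditioned on the cells outside \<open>S\<close> only. It resamples the coordinates in \<open>S\<close>, and
this keeps the index from influencing the point other than through \<open>unseen\<close>.\<close>

definition refill :: "(nat \<Rightarrow> 'a set) \<Rightarrow> (nat \<Rightarrow> 'a) measure" where
  "refill = cond_measure \<mu> (\<lambda>x. unseen (cells x))"

text \<open>How far, given that the index is \<open>z\<close>, the cell at \<open>i\<close> is from being independent of all
other cells.\<close>

definition tv_given :: "nat \<Rightarrow> (nat \<Rightarrow> 'a set) \<Rightarrow> real" where
  "tv_given i z = (let J = map_pmf (\<lambda>c. (restrict c (I - {i}), c i)) (given z) in pmf_tv J (indep_pmf J))"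

definition fibre_cost :: "(nat \<Rightarrow> 'a set) \<Rightarrow> real" where
  "fibre_cost z = (\<Sum>i\<in>I. \<epsilon> + (if i \<in> S then 1 else tv_given i z + measure (given z) {c. c i \<notin> G i})) / n"

definition mixand :: "(nat \<Rightarrow> 'a set) \<Rightarrow> (nat \<Rightarrow> 'a) measure" where
  "mixand z = measure_pmf (map_pmf unseen (given z)) \<bind> refill"

definition product_mixand :: "(nat \<Rightarrow> 'a set) \<Rightarrow> (nat \<Rightarrow> 'a) measure" where
  "product_mixand z = distr (measure_pmf (Pi_pmf I undefined (\<lambda>i. map_pmf (\<lambda>c. c i) (given z)))) N reps"

lemma simple_unseen: "simple_function \<mu> (\<lambda>x. unseen (cells x))"
  using simple_function_compose[OF simple_cells, of unseen] by (simp add: o_def)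

lemma law_unseen: "law \<mu> (\<lambda>x. unseen (cells x)) = map_pmf unseen cell_law"
  unfolding cell_law_def by (rule law_comp[OF simple_cells])

lemma refill_prob: "refill c \<in> space (prob_algebra N)"
  unfolding refill_def by (rule cond_measure_prob_algebra[OF simple_unseen sets_\<mu>])

lemma mixand_prob: "mixand z \<in> space (prob_algebra N)"
  unfolding mixand_def by (rule bind_kernel_prob_algebra[OF refill_prob])

lemma product_mixand_prob: "product_mixand z \<in> space (prob_algebra N)"
  unfolding product_mixand_def using reps_space
  by (auto simp: space_prob_algebra intro!: measure_pmf.prob_space_distr)

lemma is_product_mixand: "is_product_measure n K (product_mixand z)"
  unfolding product_mixand_def reps_def[abs_def]
  by (rule is_product_measure_Pi_pmf[OF sep rep_mspace])

lemma set_given: "z \<in> set_pmf (map_pmf seen cell_law) \<Longrightarrow> set_pmf (given z) = {c\<in>set_pmf cell_law. seen c = z}"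
  unfolding given_def by (rule set_fibre_pmf)

lemma mixture_eq: "measure_pmf (map_pmf seen cell_law) \<bind> mixand = \<mu>"
proof -
  have "measure_pmf (map_pmf seen cell_law) \<bind> mixand
      = measure_pmf (bind_pmf (map_pmf seen cell_law) (\<lambda>z. map_pmf unseen (given z))) \<bind> refill"
    unfolding mixand_def by (rule bind_pmf_kernel[OF refill_prob, symmetric])
  also have "bind_pmf (map_pmf seen cell_law) (\<lambda>z. map_pmf unseen (given z)) = law \<mu> (\<lambda>x. unseen (cells x))"
    unfolding law_unseen given_def by (rule bind_fibre_pmf)
  also have "measure_pmf \<dots> \<bind> refill = \<mu>"
    unfolding refill_def by (rule bind_cond_measure[OF simple_unseen])
  finally show ?thesis .
qed

text \<open>A point drawn from \<open>refill (unseen c)\<close> lies in the cells \<open>c i\<close> for \<open>i \<notin> S\<close>. At such a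
coordinate it is close to the representative of \<open>d i\<close> unless \<open>c i\<close> and \<open>d i\<close> differ or \<open>c i\<close> is
a bad cell; coordinates in \<open>S\<close> are charged in full.\<close>

lemma refill_cost_le:
  assumes c: "c \<in> set_pmf cell_law"
  shows "(\<integral>\<^sup>+x. ennreal (cost_bound (x, reps d)) \<partial>refill (unseen c))
    \<le> ennreal ((\<Sum>i\<in>I. \<epsilon> + (if i \<in> S then 1 else
        indicator {(c, d). c i \<noteq> d i} (c, d) + indicator {(c, d). c i \<notin> G i} (c, d))) / n)"
    (is "_ \<le> ennreal ?b")
proof -
  have mem: "unseen c \<in> set_pmf (law \<mu> (\<lambda>x. unseen (cells x)))"
    using c by (simp add: law_unseen)
  have le: "cost_bound (x, reps d) \<le> ?b"
    if x: "x \<in> space N" and eq: "unseen (cells x) = unseen c" for x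
    unfolding cost_bound_def
  proof (intro divide_right_mono sum_mono add_left_mono)
    fix i assume i: "i \<in> I"
    have xi: "x i \<in> mspace (K i)"
      using x i by (auto simp: space_N)
    have "(x, reps d) \<in> near i" if "i \<notin> S" "c i = d i" "c i \<in> G i"
    proof -
      have "quantize (P i) (x i) = c i"
        using fun_cong[OF eq, of i] i that by (simp add: unseen_def cells_def)
      then have "x i \<in> c i"
        using quantize_mem(2)[OF partition_cells[OF i] xi] by simp
      moreover from this have "reps d i \<in> c i"
        using rep_mem[OF _ xi] i that by (simp add: reps_def)
      ultimately show ?thesis
        using x that reps_space by (auto simp: near_def space_pair_measure)
    qed
    then show "1 - indicator (near i) (x, reps d) \<le> (if i \<in> S then 1 else
        indicator {(c, d). c i \<noteq> d i} (c, d) + indicator {(c, d). c i \<notin> G i} (c, d) :: real)"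
      by (auto simp: indicator_def)
  qed auto
  have "AE x in refill (unseen c). x \<in> space N"
    using AE_space[of "refill (unseen c)"] by (simp only: prob_algebraD(3)[OF refill_prob])
  moreover have "AE x in refill (unseen c). unseen (cells x) = unseen c"
    unfolding refill_def by (rule AE_cond_measure[OF simple_unseen mem])
  ultimately have "AE x in refill (unseen c). ennreal (cost_bound (x, reps d)) \<le> ennreal ?b"
    by eventually_elim (rule ennreal_leI[OF le])
  then have "(\<integral>\<^sup>+x. ennreal (cost_bound (x, reps d)) \<partial>refill (unseen c)) \<le> (\<integral>\<^sup>+x. ennreal ?b \<partial>refill (unseen c))"
    by (rule nn_integral_mono_AE)
  also have "\<dots> = ennreal ?b"
    using prob_space.emeasure_space_1[OF prob_algebraD(1)[OF refill_prob]] by simp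
  finally show ?thesis .
qed

text \<open>The labels are coupled by \<open>product_coupling\<close>, applied to the conditional law of all cells.
Only the coordinates outside \<open>S\<close> of its first component reach the refilled point.\<close>

lemma transport_mixand_le:
  assumes z: "z \<in> set_pmf (map_pmf seen cell_law)"
  shows "transport_dist n K (mixand z) (product_mixand z) \<le> ennreal (fibre_cost z)"
proof -
  have fin: "finite (set_pmf (given z))"
    using finite_cell_law by (simp add: set_given[OF z])
  obtain \<Lambda> where \<Lambda>: "map_pmf fst \<Lambda> = map_pmf (\<lambda>c. restrict c I) (given z)"
    "map_pmf snd \<Lambda> = Pi_pmf I undefined (\<lambda>i. map_pmf (\<lambda>c. c i) (given z))"
    "\<And>i. i \<in> I \<Longrightarrow> measure \<Lambda> {(c, d). c i \<noteq> d i} \<le> tv_given i z"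
    using product_coupling[OF fin, of I] unfolding tv_given_def by auto
  have fst: "map_pmf fst \<Lambda> = given z"
    unfolding \<Lambda>(1) by (rule map_pmf_idI) (auto simp: set_given[OF z] restrict_cell_law simp del: One_nat_def)
  define b where "b i w = (if i \<in> S then 1 else
      indicator {(c, d). c i \<noteq> d i} w + indicator {(c, d). c i \<notin> G i} w :: real)" for i w
  have int: "integrable \<Lambda> (b i)" for i
    unfolding b_def
    by (cases "i \<in> S") (auto intro!: Bochner_Integration.integrable_add simp: integrable_indicator_iff less_top[symmetric])
  have "mixand z = measure_pmf (map_pmf fst \<Lambda>) \<bind> (\<lambda>c. refill (unseen c))"
    unfolding mixand_def fst by (rule map_pmf_kernel[OF refill_prob])
  then have "transport_dist n K (mixand z) (product_mixand z)
      \<le> (\<integral>\<^sup>+(c, d). \<integral>\<^sup>+x. ennreal (cost_bound (x, reps d)) \<partial>refill (unseen c) \<partial>\<Lambda>)"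
    unfolding product_mixand_def \<Lambda>(2)[symmetric]
    by (simp only:) (rule transport_dist_mixture_le[OF refill_prob reps_space cost_bound_measurable],
        auto intro!: ennreal_leI avg_dist_le_cost_bound)
  also have "\<dots> \<le> (\<integral>\<^sup>+w. ennreal ((\<Sum>i\<in>I. \<epsilon> + b i w) / n) \<partial>\<Lambda>)"
  proof (rule nn_integral_mono_AE, unfold AE_measure_pmf_iff, clarify)
    fix c d assume "(c, d) \<in> set_pmf \<Lambda>"
    then have "c \<in> set_pmf (map_pmf fst \<Lambda>)"
      by force
    then have "c \<in> set_pmf cell_law"
      unfolding fst by (simp add: set_given[OF z])
    then show "(\<integral>\<^sup>+x. ennreal (cost_bound (x, reps d)) \<partial>refill (unseen c)) \<le> ennreal ((\<Sum>i\<in>I. \<epsilon> + b i (c, d)) / n)"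
      unfolding b_def by (rule refill_cost_le)
  qed
  also have "\<dots> = ennreal (measure_pmf.expectation \<Lambda> (\<lambda>w. (\<Sum>i\<in>I. \<epsilon> + b i w) / n))"
  proof (rule nn_integral_eq_integral)
    show "integrable \<Lambda> (\<lambda>w. (\<Sum>i\<in>I. \<epsilon> + b i w) / n)"
      by (intro integrable_divide Bochner_Integration.integrable_sum
          Bochner_Integration.integrable_add int) simp
  qed (use \<epsilon> in \<open>auto simp: b_def intro!: AE_I2 divide_nonneg_nonneg sum_nonneg\<close>)
  also have "measure_pmf.expectation \<Lambda> (\<lambda>w. (\<Sum>i\<in>I. \<epsilon> + b i w) / n) \<le> fibre_cost z"
  proof -
    have "measure_pmf.expectation \<Lambda> (\<lambda>w. (\<Sum>i\<in>I. \<epsilon> + b i w) / n)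
        = (\<Sum>i\<in>I. \<epsilon> + measure_pmf.expectation \<Lambda> (b i)) / n"
      by (simp add: int Bochner_Integration.integral_sum Bochner_Integration.integral_add)
    also have "\<dots> \<le> fibre_cost z"
      unfolding fibre_cost_def
    proof (intro divide_right_mono sum_mono add_left_mono)
      fix i assume i: "i \<in> I"
      show "measure_pmf.expectation \<Lambda> (b i)
          \<le> (if i \<in> S then 1 else tv_given i z + measure (given z) {c. c i \<notin> G i})"
      proof (cases "i \<in> S")
        case False
        have "measure_pmf.expectation \<Lambda> (b i)
            = measure \<Lambda> {(c, d). c i \<noteq> d i} + measure \<Lambda> {(c, d). c i \<notin> G i}"
        proof -
          have "b i = (\<lambda>w. indicator {(c, d). c i \<noteq> d i} w + indicator {(c, d). c i \<notin> G i} w)"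
            using False by (simp add: b_def fun_eq_iff)
          then show ?thesis
            by (simp add: Bochner_Integration.integral_add integrable_indicator_iff less_top[symmetric])
        qed
        moreover have "measure \<Lambda> {(c, d). c i \<notin> G i} = measure (map_pmf fst \<Lambda>) {c. c i \<notin> G i}"
          by (auto intro!: arg_cong[where f = "measure _"])
        ultimately show ?thesis
          using False \<Lambda>(3)[OF i] by (simp add: fst)
      qed (simp add: b_def[abs_def])
    qed simp
    finally show ?thesis .
  qed
  finally show ?thesis
    by (simp add: ennreal_leI)
qed

lemma fibre_cost_nonneg: "0 \<le> fibre_cost z"
  unfolding fibre_cost_def tv_given_def Let_def using \<epsilon>
  by (intro divide_nonneg_nonneg sum_nonneg add_nonneg_nonneg) (auto simp: pmf_tv_nonneg)

text \<open>Each coordinate in \<open>S\<close> costs \<open>1\<close>, each other one at most \<open>s\<close> for the coupling and \<open>\<epsilon>\<close> for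
bad cells, and every coordinate a further \<open>\<epsilon>\<close> for the diameter of the cells.\<close>

lemma average_fibre_cost_le:
  assumes s: "s > 0"
    and i: "\<And>i. i \<in> I - S \<Longrightarrow> set_entropy cell_law (insert i S) - set_entropy cell_law S
      - (set_entropy cell_law I - set_entropy cell_law (I - {i})) \<le> s\<^sup>2"
  shows "measure_pmf.expectation (map_pmf seen cell_law) fibre_cost \<le> card S / n + s + 2 * \<epsilon>"
proof -
  let ?\<nu> = "map_pmf seen cell_law"
  have fnu: "finite (set_pmf ?\<nu>)"
    using finite_cell_law by simp
  have int: "integrable ?\<nu> f" for f :: "_ \<Rightarrow> real"
    by (rule integrable_measure_pmf_finite[OF fnu])
  have bad: "measure_pmf.expectation ?\<nu> (\<lambda>z. measure (given z) {c. c i \<notin> G i}) \<le> \<epsilon>" if "i \<in> I" for i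
  proof -
    have fg: "finite (set_pmf (given z))" if "z \<in> set_pmf ?\<nu>" for z
      using finite_cell_law by (simp add: set_given[OF that])
    have "measure_pmf.expectation ?\<nu> (\<lambda>z. measure (given z) {c. c i \<notin> G i})
        = measure_pmf.expectation (bind_pmf ?\<nu> given) (indicator {c. c i \<notin> G i})"
      by (subst expectation_bind_pmf[OF fnu fg]) simp_all
    also have "bind_pmf ?\<nu> given = cell_law"
      using bind_fibre_pmf[of seen cell_law "\<lambda>c. c"] by (simp add: given_def[abs_def])
    finally show ?thesis
      using measure_bad_cells_le[OF \<open>i \<in> I\<close>] by simp
  qed
  have "measure_pmf.expectation ?\<nu> fibre_cost = (\<Sum>i\<in>I. \<epsilon> + (if i \<in> S then 1 else
      measure_pmf.expectation ?\<nu> (tv_given i)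
      + measure_pmf.expectation ?\<nu> (\<lambda>z. measure (given z) {c. c i \<notin> G i}))) / n"
  proof -
    have "measure_pmf.expectation ?\<nu> (\<lambda>z. \<epsilon> + (if i \<in> S then 1 else tv_given i z + measure (given z) {c. c i \<notin> G i}))
      = \<epsilon> + (if i \<in> S then 1 else measure_pmf.expectation ?\<nu> (tv_given i)
      + measure_pmf.expectation ?\<nu> (\<lambda>z. measure (given z) {c. c i \<notin> G i}))" for i
      by (cases "i \<in> S") (simp_all add: Bochner_Integration.integral_add[OF int int] del: integral_map_pmf)
    then show ?thesis
      unfolding fibre_cost_def integral_divide_zero
      by (subst Bochner_Integration.integral_sum) (simp_all only: int)
  qed
  also have "\<dots> \<le> (\<Sum>i\<in>I. (if i \<in> S then 1 else 0) + (s + 2 * \<epsilon>)) / n"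
  proof (intro divide_right_mono sum_mono)
    fix j assume j: "j \<in> I"
    show "\<epsilon> + (if j \<in> S then 1 else measure_pmf.expectation ?\<nu> (tv_given j)
      + measure_pmf.expectation ?\<nu> (\<lambda>z. measure (given z) {c. c j \<notin> G j}))
      \<le> (if j \<in> S then 1 else 0) + (s + 2 * \<epsilon>)"
    proof (cases "j \<in> S")
      case False
      have "measure_pmf.expectation ?\<nu> (tv_given j) \<le> s"
        using expectation_tv_le[OF finite_cell_law _ S s, of j] i[of j] j False
        unfolding tv_given_def given_def seen_def[abs_def] by simp
      then show ?thesis
        using bad[OF j] False by simp
    qed (use s \<epsilon> in simp)
  qed simp
  also have "\<dots> = card S / n + s + 2 * \<epsilon>"
  proof -
    have "(\<Sum>i\<in>I. (if i \<in> S then 1 else 0) :: real) = card S"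
      using S by (simp add: sum.If_cases Int_absorb1)
    then show ?thesis
      using n by (simp add: sum.distrib field_simps)
  qed
  finally show ?thesis .
qed

end

end

section \<open>The decomposition theorem\<close>

theorem theoremA:
  fixes n :: nat and K :: "nat \<Rightarrow> 'a metric" and \<delta> :: real and \<mu> :: "(nat \<Rightarrow> 'a) measure"
  assumes "n \<ge> 1"
    and "\<And>i. i \<in> {1..n} \<Longrightarrow> mcomplete_of (K i)"
    and "\<And>i. i \<in> {1..n} \<Longrightarrow> separable_space (mtopology_of (K i))"
    and "\<And>i x y. i \<in> {1..n} \<Longrightarrow> x \<in> mspace (K i) \<Longrightarrow> y \<in> mspace (K i) \<Longrightarrow> mdist (K i) x y \<le> 1"
    and "\<delta> > 0"
    and "\<mu> \<in> space (prob_algebra (product_borel n K))"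
    and "DTC_measure {1..n} (\<lambda>i. borel_of (mtopology_of (K i))) \<mu> \<le> ereal (\<delta> ^ 3 * real n)"
  shows "\<exists>(L :: real measure) \<nu> \<kappa>.
      \<nu> \<in> space (prob_algebra L) \<and>
      \<kappa> \<in> L \<rightarrow>\<^sub>M prob_algebra (product_borel n K) \<and>
      \<mu> = \<nu> \<bind> \<kappa> \<and>
      mixture_info L (product_borel n K) \<nu> \<kappa>
        \<le> DTC_measure {1..n} (\<lambda>i. borel_of (mtopology_of (K i))) \<mu> \<and>
      (\<exists>\<xi>. \<xi> \<in> L \<rightarrow>\<^sub>M prob_algebra (product_borel n K) \<and>
           (\<forall>y\<in>space L. is_product_measure n K (\<xi> y)) \<and>
           (\<integral>\<^sup>+ y. transport_dist n K (\<kappa> y) (\<xi> y) \<partial>\<nu>) < ennreal (2 * \<delta>))"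
proof -
  let ?I = "{1..n}" and ?N = "product_borel n K"
  let ?B = "\<lambda>i. borel_of (mtopology_of (K i))"
  note n = assms(1) and sep = assms(3) and diam = assms(4) and \<delta> = assms(5) and \<mu> = assms(6)
  interpret \<mu>: prob_space \<mu>
    using \<mu> by (rule prob_algebraD)
  have \<mu>N: "sets \<mu> = sets ?N" "space \<mu> = space ?N"
    using \<mu> by (rule prob_algebraD)+
  define \<epsilon> where "\<epsilon> = \<delta> / 100"
  have \<epsilon>: "\<epsilon> > 0"
    using \<delta> by (simp add: \<epsilon>_def)
  define small_cover where "small_cover i P G \<longleftrightarrow> P \<in> finite_partitions (?B i) \<and> G \<subseteq> P
      \<and> (\<forall>C\<in>G. \<forall>x\<in>C. \<forall>y\<in>C. mdist (K i) x y \<le> \<epsilon>)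
      \<and> measure \<mu> {x\<in>space \<mu>. x i \<notin> \<Union>G} \<le> \<epsilon>" for i P G
  have "\<exists>P G. small_cover i P G" if i: "i \<in> ?I" for i
  proof -
    have "sets ?N = sets (PiM ?I ?B)"
      by (rule sets_product_borel) (rule sep)
    from measurable_cong_sets[OF trans[OF \<mu>N(1) this] refl]
    have meas: "(\<lambda>x. x i) \<in> \<mu> \<rightarrow>\<^sub>M ?B i"
      using measurable_component_singleton[OF i] by blast
    define \<eta> where "\<eta> = distr \<mu> (?B i) (\<lambda>x. x i)"
    have "prob_space \<eta>" "sets \<eta> = sets (?B i)"
      unfolding \<eta>_def using meas by (auto intro: \<mu>.prob_space_distr)
    from exists_small_partition[OF sep[OF i] this \<epsilon>] obtain P G where PG:
      "P \<in> finite_partitions (?B i)" "G \<subseteq> P" "\<forall>C\<in>G. \<forall>x\<in>C. \<forall>y\<in>C. mdist (K i) x y \<le> \<epsilon>"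
      "measure \<eta> (mspace (K i) - \<Union>G) \<le> \<epsilon>"
      by blast
    have "G \<subseteq> sets (?B i)" "finite G"
      using PG(1,2) by (auto simp: finite_partitions_def intro: finite_subset)
    then have "\<Union>G \<in> sets (?B i)"
      by (intro sets.finite_Union) auto
    then have "mspace (K i) - \<Union>G \<in> sets (?B i)"
      using sets.compl_sets[of "\<Union>G" "?B i"] by simp
    then have "measure \<eta> (mspace (K i) - \<Union>G) = measure \<mu> {x\<in>space \<mu>. x i \<notin> \<Union>G}"
      unfolding \<eta>_def using measurable_space[OF meas]
      by (subst measure_distr[OF meas]) (auto intro!: arg_cong[where f = "measure \<mu>"])
    then show ?thesis
      using PG unfolding small_cover_def by auto
  qed
  then obtain P G where "\<And>i. i \<in> ?I \<Longrightarrow> small_cover i (P i) (G i)"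
    by metis
  then have PG: "\<And>i. i \<in> ?I \<Longrightarrow> P i \<in> finite_partitions (?B i)"
    "\<And>i. i \<in> ?I \<Longrightarrow> G i \<subseteq> P i"
    "\<And>i C x y. i \<in> ?I \<Longrightarrow> C \<in> G i \<Longrightarrow> x \<in> C \<Longrightarrow> y \<in> C \<Longrightarrow> mdist (K i) x y \<le> \<epsilon>"
    "\<And>i. i \<in> ?I \<Longrightarrow> measure \<mu> {x\<in>space \<mu>. x i \<notin> \<Union>(G i)} \<le> \<epsilon>"
    unfolding small_cover_def by blast+
  interpret small_cells n K \<mu> P G \<epsilon>
    by (unfold_locales; fact n sep diam \<mu> \<epsilon> PG)
  \<comment> \<open>A saturated set for the threshold \<open>s\<^sup>2\<close> costs at most \<open>\<delta>\<^sup>3 / s\<^sup>2 + s\<close>. The value of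
    \<open>s\<close> is close to the minimizer \<open>2 powr (1/3) * \<delta>\<close> and leaves more than \<open>\<delta> / 10\<close> for the
    quantization error \<open>2 * \<epsilon>\<close>.\<close>
  define s where "s = 6 / 5 * \<delta>"
  have s: "s > 0"
    using \<delta> by (simp add: s_def)
  obtain S where S: "S \<subseteq> ?I" "s\<^sup>2 * card S \<le> pmf_DTC ?I cell_law"
    and sat: "\<And>i. i \<in> ?I - S \<Longrightarrow> set_entropy cell_law (insert i S) - set_entropy cell_law S
      - (set_entropy cell_law ?I - set_entropy cell_law (?I - {i})) < s\<^sup>2"
    using saturated_subset[OF finite_cell_law, of ?I "s\<^sup>2"] s by auto
  define \<nu> where "\<nu> = map_pmf (seen S) cell_law"
  have fnu: "finite (set_pmf \<nu>)"
    using finite_cell_law by (simp add: \<nu>_def)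
  obtain e0 :: "(nat \<Rightarrow> 'a set) \<Rightarrow> nat" where "inj_on e0 (set_pmf \<nu>)"
    using finite_imp_inj_to_nat_seg[OF fnu] by blast
  \<comment> \<open>The index takes finitely many values, which are encoded as real numbers.\<close>
  define e where "e z = real (e0 z)" for z
  have e: "inj_on e (set_pmf \<nu>)"
    using \<open>inj_on e0 (set_pmf \<nu>)\<close> by (auto simp: e_def inj_on_def)
  define dec where "dec = inv_into (set_pmf \<nu>) e"
  have dec: "dec (e z) = z" if "z \<in> set_pmf \<nu>" for z
    unfolding dec_def using e that by (rule inv_into_f_f)
  let ?L = "count_space UNIV :: real measure"
  let ?\<nu> = "measure_pmf (map_pmf e \<nu>)"
  let ?\<kappa> = "\<lambda>y. mixand S (dec y)" and ?\<xi> = "\<lambda>y. product_mixand S (dec y)"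
  note mixand_prob = mixand_prob[OF S(1)]
  have 1: "?\<nu> \<in> space (prob_algebra ?L)"
    by (simp add: space_prob_algebra measure_pmf.prob_space_axioms)
  have 2: "?\<kappa> \<in> ?L \<rightarrow>\<^sub>M prob_algebra ?N" "?\<xi> \<in> ?L \<rightarrow>\<^sub>M prob_algebra ?N"
    using mixand_prob product_mixand_prob[OF S(1)] by auto
  have 3: "\<mu> = ?\<nu> \<bind> ?\<kappa>"
  proof -
    have "?\<nu> \<bind> ?\<kappa> = measure_pmf \<nu> \<bind> (\<lambda>z. mixand S (dec (e z)))"
      by (rule map_pmf_kernel[OF mixand_prob])
    also have "\<dots> = measure_pmf \<nu> \<bind> mixand S"
      by (rule bind_kernel_cong[of _ ?N]) (use mixand_prob dec in auto)
    also have "\<dots> = \<mu>"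
      unfolding \<nu>_def by (rule mixture_eq[OF S(1)])
    finally show ?thesis ..
  qed
  have 4: "mixture_info ?L ?N ?\<nu> ?\<kappa> \<le> DTC_measure ?I ?B \<mu>"
  proof -
    let ?k = "\<lambda>z. map_pmf (unseen S) (given S z)"
    have J: "joint_pmf (map_pmf e \<nu>) (\<lambda>y. ?k (dec y))
        = map_pmf (map_prod e (\<lambda>c. c)) (map_pmf (\<lambda>c. (seen S c, unseen S c)) cell_law)"
    proof -
      have "joint_pmf (map_pmf e \<nu>) (\<lambda>y. ?k (dec y)) = bind_pmf \<nu> (\<lambda>z. map_pmf (Pair (e z)) (?k z))"
        unfolding joint_pmf_def bind_map_pmf by (rule bind_pmf_cong) (auto simp: dec)
      also have "\<dots> = map_pmf (map_prod e (\<lambda>c. c)) (joint_pmf \<nu> ?k)"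
        by (simp add: joint_pmf_def map_bind_pmf pmf.map_comp o_def)
      also have "joint_pmf \<nu> ?k = map_pmf (\<lambda>c. (seen S c, unseen S c)) cell_law"
        unfolding \<nu>_def given_def[OF S(1)] by (rule joint_fibre_pmf)
      finally show ?thesis .
    qed
    have "mixture_info ?L ?N ?\<nu> ?\<kappa> \<le> ereal (pmf_MI (joint_pmf (map_pmf e \<nu>) (\<lambda>y. ?k (dec y))))"
      unfolding mixand_def[OF S(1)]
      by (rule mixture_info_le_pmf_MI[OF refill_prob[OF S(1)]]) (simp add: J finite_cell_law)
    also have "pmf_MI (joint_pmf (map_pmf e \<nu>) (\<lambda>y. ?k (dec y)))
        \<le> pmf_MI (map_pmf (\<lambda>c. (seen S c, unseen S c)) cell_law)"
      unfolding J by (rule pmf_MI_map_le) (simp add: finite_cell_law)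
    also have "\<dots> \<le> pmf_DTC ?I cell_law"
      unfolding seen_def[OF S(1)] unseen_def[OF S(1)]
      by (rule pmf_MI_split_le_DTC[OF finite_cell_law _ S(1)]) simp
    also have "ereal \<dots> \<le> DTC_measure ?I ?B \<mu>"
      by (rule pmf_DTC_le)
    finally show ?thesis by simp
  qed
  have 5: "(\<integral>\<^sup>+y. transport_dist n K (?\<kappa> y) (?\<xi> y) \<partial>?\<nu>) < ennreal (2 * \<delta>)"
  proof -
    have "(\<integral>\<^sup>+y. transport_dist n K (?\<kappa> y) (?\<xi> y) \<partial>?\<nu>)
        = (\<integral>\<^sup>+z. transport_dist n K (?\<kappa> (e z)) (?\<xi> (e z)) \<partial>\<nu>)"
      by simp
    also have "\<dots> \<le> (\<integral>\<^sup>+z. ennreal (fibre_cost S z) \<partial>\<nu>)"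
      by (rule nn_integral_mono_AE)
         (auto simp: AE_measure_pmf_iff dec \<nu>_def intro!: transport_mixand_le[OF S(1)])
    also have "\<dots> = ennreal (measure_pmf.expectation \<nu> (fibre_cost S))"
      by (rule nn_integral_eq_integral[OF integrable_measure_pmf_finite[OF fnu]])
         (auto intro: fibre_cost_nonneg[OF S(1)])
    also have "\<dots> < ennreal (2 * \<delta>)"
    proof (rule ennreal_lessI)
      have "pmf_DTC ?I cell_law \<le> \<delta> ^ 3 * n"
        using order_trans[OF pmf_DTC_le assms(7)] by simp
      then have "s\<^sup>2 * card S \<le> \<delta> ^ 3 * n"
        using S(2) by simp
      then have "\<delta>\<^sup>2 * (36 / 25 * card S) \<le> \<delta>\<^sup>2 * (\<delta> * n)"
        by (simp add: s_def power2_eq_square power3_eq_cube mult_ac)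
      then have "36 / 25 * card S \<le> \<delta> * n"
        using \<delta> by (simp only: mult_le_cancel_left_pos zero_less_power)
      then have "card S / n \<le> 25 / 36 * \<delta>"
        using n by (simp add: field_simps)
      moreover have "measure_pmf.expectation \<nu> (fibre_cost S) \<le> card S / n + s + 2 * \<epsilon>"
        unfolding \<nu>_def using average_fibre_cost_le[OF S(1) s] sat by (auto intro: less_imp_le)
      ultimately show "measure_pmf.expectation \<nu> (fibre_cost S) < 2 * \<delta>"
        using \<delta> by (simp add: s_def \<epsilon>_def)
    qed (use \<delta> in simp)
    finally show ?thesis .
  qed
  show ?thesis
    by (rule exI[of _ ?L], rule exI[of _ ?\<nu>], rule exI[of _ ?\<kappa>])
       (use 1 2 3 4 5 is_product_mixand[OF S(1)] in blast)
qed

end
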